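(* For each $n\ge2$, there exists a unique continuous $\mathbf F_q$-linear solution $l_n:O_\pi\to\Omega_\pi$ of the equation $$\Delta l_n=l_{n-1}$$ coinciding for $|t|_\pi\le q^{-\delta}$ with $$\sum_{j=1}^\infty\frac{t^{q^j}}{[j]^n}.$$ (Here $l_1$ is the fixed function described in the context, and for $n\ge 3$ the function $l_{n-1}$ is the solution obtained at the previous step.) The solution is given by the Carlitz expansion $$l_n=\sum_{i=0}^\infty c_i^{(n)}f_i,\qquad c_i^{(n)}\in\Omega_\pi,$$ with $$\left|c_i^{(n)}\right|_\pi\le C_nq^{-\delta q^{i-\delta}},\quad i>\delta,$$ for some constant $C_n>0$ (independent of $i$), and $$c_0^{(n)}=\sum_{i=1}^\infty(-1)^{i+1}\frac{c_i^{(n)}}{L_i}.$$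
   Context: Let $\mathbf F_q$ be the finite field with $q$ elements, and let $\pi\in\mathbf F_q[x]$ be a monic irreducible polynomial of degree $\delta$. Let $|\cdot|_\pi$ be the $\pi$-adic absolute value on $\mathbf F_q(x)$ normalized by $|\pi|_\pi=q^{-\delta}$, $K_\pi$ the completion of $\mathbf F_q(x)$ with respect to it, $\Omega_\pi$ the completion of an algebraic closure of $K_\pi$ (with the canonically extended absolute value), and $O_\pi=\{t\in K_\pi:\ |t|_\pi\le1\}$. All variables $t$ lie in $K_\pi$. A function $f$ on an $\mathbf F_q$-subspace of $K_\pi$ with values in $\Omega_\pi$ is $\mathbf F_q$-linear if $f(t_1+t_2)=f(t_1)+f(t_2)$ and $f(\alpha t)=\alpha f(t)$ for all $t,t_1,t_2$ in the subspace and $\alpha\in\mathbf F_q$. Operators: $(\Delta u)(t)=u(xt)-xu(t)$; $(du)(t)=\big((\Delta u)(t)\big)^{1/q}$ (the unique $q$-th root in $\Omega_\pi$); $(\tau u)(t)=u(t)^q$. Notation: $[n]=x^{q^n}-x$ for $n\ge1$; $L_i=[i][i-1]\cdots[1]$ for $i\ge1$; $D_0=1$, $D_i=[i][i-1]^q\cdots[1]^{q^{i-1}}$; $e_0(t)=t$, $e_i(t)=\prod_{\omega\in\mathbf F_q[x],\ \deg\omega<i}(t-\omega)$ for $i\ge1$ (the product including $\omega=0$); the normalized Carlitz polynomials are $f_i(t)=D_i^{-1}e_i(t)$, $i\ge0$. The sequence $\{f_i\}$ is an orthonormal basis of the space of continuous $\mathbf F_q$-linear functions $O_\pi\to\Omega_\pi$.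 The function $l_1$: a fixed continuous $\mathbf F_q$-linear solution $u=l_1:O_\pi\to\Omega_\pi$ of $(1-\tau)du(t)=t$ (that is, $du(t)-\Delta u(t)=t$) coinciding with $\sum_{n=1}^\infty t^{q^n}/[n]$ for $|t|_\pi\le q^{-\delta}$. Explicitly, $l_1=\sum_{i\ge0}c_if_i$, where $c_1,\ldots,c_\delta\in\Omega_\pi$ are some fixed solutions of $c_1^q-c_1+1=0$ and $c_{i+1}^q-c_{i+1}+[i]^qc_i^q=0$ ($1\le i\le\delta-1$), $c_n=\sum_{j=0}^\infty(c_{n-1}[n-1])^{q^{j+1}}$ for $n\ge\delta+1$, and $c_0=\sum_{i=1}^\infty(-1)^{i+1}c_i/L_i$. *)

theory Defs
  imports "HOL-Analysis.Analysis" "HOL-Algebra.Algebraic_Closure_Type"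
begin

text \<open>
  Throughout, \<open>'f\<close> is the finite field of constants, so \<open>q = CARD('f)\<close>, and the rational function
  field is the type \<open>'f poly fract\<close>. The field \<open>\<Omega>\<close> is a type \<open>'c :: {field, complete_space}\<close> whose
  absolute value is \<open>|z| = dist z 0\<close>; it is specified, together with the embedding \<open>\<iota>\<close> of the
  rational function field, up to isometric isomorphism by \<open>is_Omega\<close> below.
\<close>

definition av :: "'c::{field,metric_space} \<Rightarrow> real" where
  "av z = dist z 0"

definition K_set :: "('f::{field,finite} poly fract \<Rightarrow> 'c::{field,complete_space}) \<Rightarrow> 'c set" where
  \<comment> \<open>a closed subset of a complete space, hence the completion of \<open>range \<iota>\<close>\<close>
  "K_set \<iota> = closure (range \<iota>)"

definition O_set :: "('f::{field,finite} poly fract \<Rightarrow> 'c::{field,complete_space}) \<Rightarrow> 'c set" where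
  "O_set \<iota> = {t \<in> K_set \<iota>. av t \<le> 1}"

text \<open>
  The library's \<open>multiplicity\<close> would need class \<open>field_gcd\<close> for \<open>'f\<close>. The following is meant
  for \<open>p \<noteq> 0\<close> and \<open>\<pi>\<close> of positive degree, where the greatest exponent exists.
\<close>

definition pi_order :: "'f::field poly \<Rightarrow> 'f poly \<Rightarrow> nat" where
  "pi_order \<pi> p = (GREATEST n. \<pi> ^ n dvd p)"

definition is_Omega ::
  "'f::{field,finite} poly \<Rightarrow> ('f poly fract \<Rightarrow> 'c::{field,complete_space}) \<Rightarrow> bool" where
  "is_Omega \<pi> \<iota> \<longleftrightarrow>
     \<comment> \<open>the metric comes from a non-Archimedean absolute value\<close>
     (\<forall>y z :: 'c. dist y z = av (y - z)) \<and>
     (\<forall>y z :: 'c. av (y * z) = av y * av z) \<and>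
     (\<forall>y z :: 'c. av (y + z) \<le> max (av y) (av z)) \<and>
     \<comment> \<open>\<open>\<iota>\<close> is a field embedding that is isometric for the normalized \<open>\<pi>\<close>-adic absolute value\<close>
     \<iota> 1 = 1 \<and>
     (\<forall>r s. \<iota> (r + s) = \<iota> r + \<iota> s) \<and>
     (\<forall>r s. \<iota> (r * s) = \<iota> r * \<iota> s) \<and>
     (\<forall>a b. a \<noteq> 0 \<longrightarrow> b \<noteq> 0 \<longrightarrow>
        av (\<iota> (Fract a b)) = real CARD('f) powr
          (- (real (Polynomial.degree \<pi>) * (real (pi_order \<pi> a) - real (pi_order \<pi> b))))) \<and>
     \<comment> \<open>the whole space is the completion of an algebraic closure \<open>A\<close> of \<open>K_set \<iota>\<close>\<close>
     (\<exists>A. algebraic_closure ((ring_of_type_algebra :: 'c ring)\<lparr>carrier := A\<rparr>) (K_set \<iota>) \<and>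
          closure A = UNIV)"

definition emb :: "('f::{field,finite} poly fract \<Rightarrow> 'c::field) \<Rightarrow> 'f poly \<Rightarrow> 'c" where
  "emb \<iota> p = \<iota> (Fract p 1)"

definition xvar :: "('f::{field,finite} poly fract \<Rightarrow> 'c::field) \<Rightarrow> 'c" where
  "xvar \<iota> = emb \<iota> [:0, 1:]"

definition Fq_linear_on ::
  "('f::{field,finite} poly fract \<Rightarrow> 'c::field) \<Rightarrow> 'c set \<Rightarrow> ('c \<Rightarrow> 'c) \<Rightarrow> bool" where
  "Fq_linear_on \<iota> S u \<longleftrightarrow>
     (\<forall>t1\<in>S. \<forall>t2\<in>S. u (t1 + t2) = u t1 + u t2) \<and>
     (\<forall>\<alpha>. \<forall>t\<in>S. u (emb \<iota> [:\<alpha>:] * t) = emb \<iota> [:\<alpha>:] * u t)"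

definition Delta_op :: "('f::{field,finite} poly fract \<Rightarrow> 'c::field) \<Rightarrow> ('c \<Rightarrow> 'c) \<Rightarrow> 'c \<Rightarrow> 'c" where
  "Delta_op \<iota> u t = u (xvar \<iota> * t) - xvar \<iota> * u t"

definition d_op :: "('f::{field,finite} poly fract \<Rightarrow> 'c::field) \<Rightarrow> ('c \<Rightarrow> 'c) \<Rightarrow> 'c \<Rightarrow> 'c" where
  "d_op \<iota> u t = (THE y. y ^ CARD('f) = Delta_op \<iota> u t)"

definition tau_op :: "('f::{field,finite} poly fract \<Rightarrow> 'c::field) \<Rightarrow> ('c \<Rightarrow> 'c) \<Rightarrow> 'c \<Rightarrow> 'c" where
  \<comment> \<open>\<open>\<iota>\<close> only carries the type \<open>'f\<close>, i.e. the value of \<open>q\<close>\<close>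
  "tau_op \<iota> u t = u t ^ CARD('f)"

definition bracket :: "('f::{field,finite} poly fract \<Rightarrow> 'c::field) \<Rightarrow> nat \<Rightarrow> 'c" where
  "bracket \<iota> n = xvar \<iota> ^ (CARD('f) ^ n) - xvar \<iota>"

definition L_seq :: "('f::{field,finite} poly fract \<Rightarrow> 'c::field) \<Rightarrow> nat \<Rightarrow> 'c" where
  "L_seq \<iota> i = (\<Prod>k=1..i. bracket \<iota> k)"

definition D_seq :: "('f::{field,finite} poly fract \<Rightarrow> 'c::field) \<Rightarrow> nat \<Rightarrow> 'c" where
  "D_seq \<iota> i = (\<Prod>k=1..i. bracket \<iota> k ^ (CARD('f) ^ (i - k)))"

definition e_poly :: "('f::{field,finite} poly fract \<Rightarrow> 'c::field) \<Rightarrow> nat \<Rightarrow> 'c \<Rightarrow> 'c" where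
  \<comment> \<open>\<open>degree 0 = 0\<close>, so for \<open>i \<ge> 1\<close> the product includes the factor for \<open>\<omega> = 0\<close>\<close>
  "e_poly \<iota> i t = (if i = 0 then t else (\<Prod>\<omega> | Polynomial.degree \<omega> < i. t - emb \<iota> \<omega>))"

definition f_poly :: "('f::{field,finite} poly fract \<Rightarrow> 'c::field) \<Rightarrow> nat \<Rightarrow> 'c \<Rightarrow> 'c" where
  "f_poly \<iota> i t = inverse (D_seq \<iota> i) * e_poly \<iota> i t"

text \<open>Elements of \<open>O_set \<iota> \<rightarrow>\<^sub>E UNIV\<close> are the functions with domain \<open>O_set \<iota>\<close>.\<close>

definition cont_linear ::
  "('f::{field,finite} poly fract \<Rightarrow> 'c::{field,complete_space}) \<Rightarrow> ('c \<Rightarrow> 'c) \<Rightarrow> bool" where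
  "cont_linear \<iota> u \<longleftrightarrow>
     u \<in> O_set \<iota> \<rightarrow>\<^sub>E UNIV \<and> continuous_on (O_set \<iota>) u \<and> Fq_linear_on \<iota> (O_set \<iota>) u"

text \<open>Expansions are understood in the Banach space of continuous functions with the sup norm.\<close>

definition carlitz_expansion ::
  "('f::{field,finite} poly fract \<Rightarrow> 'c::{field,complete_space}) \<Rightarrow> (nat \<Rightarrow> 'c) \<Rightarrow> ('c \<Rightarrow> 'c) \<Rightarrow> bool" where
  "carlitz_expansion \<iota> c u \<longleftrightarrow>
     uniform_limit (O_set \<iota>) (\<lambda>N t. \<Sum>i<N. c i * f_poly \<iota> i t) u sequentially"

definition coincides_with_polylog_series ::
  "'f::{field,finite} poly \<Rightarrow> ('f poly fract \<Rightarrow> 'c::{field,complete_space}) \<Rightarrow>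
   nat \<Rightarrow> ('c \<Rightarrow> 'c) \<Rightarrow> bool" where
  "coincides_with_polylog_series \<pi> \<iota> n u \<longleftrightarrow>
     (\<forall>t\<in>K_set \<iota>. av t \<le> real CARD('f) powr (- real (Polynomial.degree \<pi>)) \<longrightarrow>
        (\<lambda>k. t ^ (CARD('f) ^ Suc k) / bracket \<iota> (Suc k) ^ n) sums u t)"

text \<open>\<open>c\<^sub>0 = \<Sum>\<^sub>i\<^sub>\<ge>\<^sub>1 (-1)\<^sup>i\<^sup>+\<^sup>1 c\<^sub>i / L\<^sub>i\<close>, with \<open>i = Suc k\<close>\<close>

definition c0_relation ::
  "('f::{field,finite} poly fract \<Rightarrow> 'c::{field,complete_space}) \<Rightarrow> (nat \<Rightarrow> 'c) \<Rightarrow> bool" where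
  "c0_relation \<iota> c \<longleftrightarrow>
     (\<lambda>k. (- 1) ^ (Suc k + 1) * c (Suc k) / L_seq \<iota> (Suc k)) sums c 0"

definition l1_coefficients ::
  "'f::{field,finite} poly \<Rightarrow> ('f poly fract \<Rightarrow> 'c::{field,complete_space}) \<Rightarrow> (nat \<Rightarrow> 'c) \<Rightarrow> bool" where
  "l1_coefficients \<pi> \<iota> c \<longleftrightarrow>
     c 1 ^ CARD('f) - c 1 + 1 = 0 \<and>
     (\<forall>i. 1 \<le> i \<longrightarrow> i < Polynomial.degree \<pi> \<longrightarrow>
        c (i + 1) ^ CARD('f) - c (i + 1) + bracket \<iota> i ^ CARD('f) * c i ^ CARD('f) = 0) \<and>
     (\<forall>n\<ge>Polynomial.degree \<pi> + 1.
        (\<lambda>j. (c (n - 1) * bracket \<iota> (n - 1)) ^ (CARD('f) ^ (j + 1))) sums c n) \<and>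
     c0_relation \<iota> c"

definition is_l1 ::
  "'f::{field,finite} poly \<Rightarrow> ('f poly fract \<Rightarrow> 'c::{field,complete_space}) \<Rightarrow> ('c \<Rightarrow> 'c) \<Rightarrow> bool" where
  "is_l1 \<pi> \<iota> u \<longleftrightarrow>
     cont_linear \<iota> u \<and>
     (\<forall>t\<in>O_set \<iota>. d_op \<iota> u t - tau_op \<iota> (d_op \<iota> u) t = t) \<and>
     coincides_with_polylog_series \<pi> \<iota> 1 u \<and>
     (\<exists>c. l1_coefficients \<pi> \<iota> c \<and> carlitz_expansion \<iota> c u)"

definition polylog_solution ::
  "'f::{field,finite} poly \<Rightarrow> ('f poly fract \<Rightarrow> 'c::{field,complete_space}) \<Rightarrow>
   nat \<Rightarrow> ('c \<Rightarrow> 'c) \<Rightarrow> ('c \<Rightarrow> 'c) \<Rightarrow> bool" where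
  "polylog_solution \<pi> \<iota> n v u \<longleftrightarrow>
     cont_linear \<iota> u \<and>
     (\<forall>t\<in>O_set \<iota>. Delta_op \<iota> u t = v t) \<and>
     coincides_with_polylog_series \<pi> \<iota> n u"

end

theory Submission
  imports Defs
begin

text \<open>
  Write \<open>q = CARD('f)\<close>. The Carlitz polynomials satisfy \<open>f\<^bsub>i+1\<^esub> = (f\<^sub>i\<^sup>q - f\<^sub>i) / [i+1]\<close> and
  \<open>\<Delta> f\<^bsub>i+1\<^esub> = f\<^sub>i\<^sup>q = [i+1] f\<^bsub>i+1\<^esub> + f\<^sub>i\<close>, so \<open>\<Delta> l\<^sub>n = l\<^bsub>n-1\<^esub>\<close> becomes the recursion
  \<open>c'\<^bsub>i+1\<^esub> + [i] c'\<^sub>i = c\<^sub>i\<close>. It is solved by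
  \<open>c'\<^bsub>i+1\<^esub> = (-1)\<^sup>i L\<^sub>i \<Sum>\<^bsub>j\<le>i\<^esub> (-1)\<^sup>j c\<^sub>j / L\<^sub>j\<close>. As \<open>(-1)\<^sup>j / L\<^sub>j\<close> is the derivative of \<open>f\<^sub>j\<close> at
  \<open>0\<close>, the relation for \<open>c\<^sub>0\<close> says that the full sum vanishes; the partial sum is therefore minus a tail,
  which transports the double exponential decay from \<open>c\<close> to \<open>c'\<close>. The coefficient \<open>c'\<^sub>0\<close> is free,
  because the continuous linear solutions of \<open>\<Delta> w = 0\<close> are the multiples of \<open>t\<close>. The same fact gives
  uniqueness, and it reduces the agreement with the series near \<open>0\<close> to the vanishing of the derivative
  at \<open>0\<close>, which fixes \<open>c'\<^sub>0\<close>.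
\<close>

section \<open>Finite fields and elementary inequalities\<close>

text \<open>Multiplication by \<open>a \<noteq> 0\<close> permutes the nonzero elements; comparing
  their product before and after gives a^(q-1) = 1.\<close>

lemma finite_field_power_card:
  fixes a :: "'f::{field,finite}"
  shows "a ^ CARD('f) = a"
proof (cases "a = 0")
  case False
  let ?U = "UNIV - {0::'f}"
  have "(\<Prod>b\<in>?U. a * b) = (\<Prod>b\<in>?U. b)"
    by (rule prod.reindex_bij_witness[of _ "\<lambda>b. b / a" "\<lambda>b. a * b"]) (use False in auto)
  moreover have "(\<Prod>b\<in>?U. a * b) = a ^ card ?U * (\<Prod>b\<in>?U. b)"
    by (simp add: prod.distrib)
  moreover have "(\<Prod>b\<in>?U. b) \<noteq> 0"
    by simp
  ultimately have "a ^ card ?U = 1"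
    by simp
  moreover have "CARD('f) = Suc (card ?U)"
    by (rule card.remove) simp_all
  ultimately show ?thesis
    by (metis mult.right_neutral power_Suc)
qed simp

text \<open>Translation by 1 permutes the field, so the sum of all elements changes by q * 1 and yet
  stays the same.\<close>

lemma of_nat_card_finite_field: "of_nat CARD('f) = (0 :: 'f::{field,finite})"
proof -
  have "(\<Sum>a\<in>(UNIV::'f set). a + 1) = (\<Sum>a\<in>UNIV. a)"
    by (rule sum.reindex_bij_witness[of _ "\<lambda>b. b - 1" "\<lambda>b. b + 1"]) auto
  then show ?thesis
    by (simp add: sum.distrib)
qed

lemma card_finite_field_ge_2: "CARD('f::{field,finite}) \<ge> 2"
proof -
  have "card {0, 1 :: 'f} \<le> CARD('f)"
    by (rule card_mono) auto
  then show ?thesis by simp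
qed

lemma twice_le_power:
  assumes "2 \<le> (a::nat)"
  shows "2 * n \<le> a ^ n"
proof (induction n)
  case (Suc n)
  show ?case
  proof (cases n)
    case 0
    then show ?thesis using assms by simp
  next
    case (Suc m)
    then have "2 * Suc n \<le> 2 * (2 * n)" by simp
    also have "\<dots> \<le> a * a ^ n" using Suc.IH assms by (intro mult_mono) auto
    finally show ?thesis by simp
  qed
qed simp

text \<open>Serves to absorb a factor \<open>Q ^ d\<close> into the double exponential decay of the
  coefficients.\<close>

lemma power_add_le_power:
  assumes "2 \<le> (a::nat)"
  shows "a ^ m + n \<le> a ^ (m + n)"
proof (induction n)
  case (Suc n)
  have "a ^ m + Suc n \<le> 2 * (a ^ m + n)" using assms by (simp add: Suc_le_eq)
  also have "\<dots> \<le> a * a ^ (m + n)" using Suc assms by (intro mult_mono) auto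
  finally show ?case by simp
qed simp

locale carlitz =
  fixes \<pi> :: "'f::{field,finite} poly"
    and \<iota> :: "'f poly fract \<Rightarrow> 'c::{field,complete_space}"
  assumes irreducible_pi: "Factorial_Ring.irreducible \<pi>"
    and monic_pi: "Polynomial.lead_coeff \<pi> = 1"
    and is_Omega: "is_Omega \<pi> \<iota>"
begin

abbreviation \<delta> :: nat where "\<delta> \<equiv> Polynomial.degree \<pi>"
text \<open>\<open>Q\<close> is the inverse of the absolute value of \<pi>; division by a bracket of
  positive index enlarges an absolute value by at most this factor.\<close>

abbreviation Q :: real where "Q \<equiv> real CARD('f) ^ \<delta>"
abbreviation \<xi> :: 'c where "\<xi> \<equiv> xvar \<iota>"
abbreviation P :: 'c where "P \<equiv> emb \<iota> \<pi>"
abbreviation k :: "'f \<Rightarrow> 'c" where "k \<alpha> \<equiv> emb \<iota> [:\<alpha>:]"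
abbreviation br :: "nat \<Rightarrow> 'c" where "br \<equiv> bracket \<iota>"
abbreviation O\<^sub>\<pi> :: "'c set" where "O\<^sub>\<pi> \<equiv> O_set \<iota>"
abbreviation K\<^sub>\<pi> :: "'c set" where "K\<^sub>\<pi> \<equiv> K_set \<iota>"

lemma q_ge_2: "CARD('f) \<ge> 2"
  by (rule card_finite_field_ge_2)

lemma degree_pi_pos: "\<delta> > 0"
proof (rule ccontr)
  assume "\<not> \<delta> > 0"
  moreover have "\<pi> \<noteq> 0" using monic_pi by auto
  ultimately have "\<pi> dvd 1" by (simp add: is_unit_iff_degree)
  then show False using irreducible_pi irreducible_not_unit by blast
qed

lemma Q_gt_1: "Q > 1"
  using q_ge_2 degree_pi_pos by (intro one_less_power) auto

lemma Q_pos: "Q > 0"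
  using Q_gt_1 by linarith

subsection \<open>Ultrametric calculus\<close>

lemma dist_av: "dist y z = av (y - z :: 'c)"
  and av_mult: "av (y * z) = av y * av (z :: 'c)"
  and av_ultra: "av (y + z) \<le> max (av y) (av (z :: 'c))"
  using is_Omega[unfolded is_Omega_def, THEN conjunct1]
    is_Omega[unfolded is_Omega_def, THEN conjunct2, THEN conjunct1]
    is_Omega[unfolded is_Omega_def, THEN conjunct2, THEN conjunct2, THEN conjunct1]
  by simp_all

lemma av_nonneg [simp]: "av (z :: 'c) \<ge> 0"
  by (simp add: av_def)

lemma av_eq_0_iff [simp]: "av (z :: 'c) = 0 \<longleftrightarrow> z = 0"
  by (simp add: av_def)

lemma av_zero [simp]: "av (0 :: 'c) = 0"
  by simp

lemma av_one [simp]: "av (1 :: 'c) = 1"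
  using av_mult[of 1 1] by auto

lemma av_minus [simp]: "av (- z) = av (z :: 'c)"
  using dist_av[of 0 z] dist_av[of z 0] by (simp add: dist_commute)

lemma av_diff_commute: "av (y - z) = av (z - y :: 'c)"
  using av_minus[of "y - z"] by simp

lemma av_diff: "av (y - z) \<le> max (av y) (av (z :: 'c))"
  using av_ultra[of y "- z"] by simp

lemma av_add_le: "av y \<le> B \<Longrightarrow> av z \<le> B \<Longrightarrow> av (y + z :: 'c) \<le> B"
  using av_ultra[of y z] by simp

lemma av_diff_le: "av y \<le> B \<Longrightarrow> av z \<le> B \<Longrightarrow> av (y - z :: 'c) \<le> B"
  using av_diff[of y z] by simp

lemma av_power: "av (z ^ n) = av (z :: 'c) ^ n"
  by (induction n) (simp_all add: av_mult)

lemma av_inverse: "av (inverse z) = inverse (av (z :: 'c))"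
proof (cases "z = 0")
  case False
  then have "av z * av (inverse z) = 1"
    by (simp flip: av_mult)
  then show ?thesis
    by (metis inverse_unique)
qed simp

lemma av_divide: "av (y / z) = av y / av (z :: 'c)"
  by (simp add: divide_inverse av_mult av_inverse)

lemma av_prod: "av (prod g A) = (\<Prod>a\<in>A. av (g a :: 'c))"
  by (induction A rule: infinite_finite_induct) (simp_all add: av_mult)

lemma av_sum_le:
  assumes "\<And>a. a \<in> A \<Longrightarrow> av (g a :: 'c) \<le> B" "B \<ge> 0"
  shows "av (sum g A) \<le> B"
  using assms by (induction A rule: infinite_finite_induct) (auto intro: av_add_le)

lemma av_neg_one_power [simp]: "av ((- 1) ^ n :: 'c) = 1"
  by (simp add: av_power)

lemma tendsto_av_iff: "(g \<longlongrightarrow> l) F \<longleftrightarrow> ((\<lambda>x. av (g x - l :: 'c)) \<longlongrightarrow> 0) F"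
  by (simp add: tendsto_dist_iff[of g] dist_av)

lemma tendsto_0_av_iff: "(g \<longlongrightarrow> 0) F \<longleftrightarrow> ((\<lambda>x. av (g x :: 'c)) \<longlongrightarrow> 0) F"
  by (simp add: tendsto_av_iff)

lemma tendsto_0_av_le:
  fixes g :: "'a \<Rightarrow> 'c"
  assumes "\<And>x. av (g x) \<le> h x" "(h \<longlongrightarrow> 0) F"
  shows "(g \<longlongrightarrow> 0) F"
  unfolding tendsto_0_av_iff
proof (rule tendsto_sandwich[OF _ _ tendsto_const assms(2)])
  show "\<forall>\<^sub>F x in F. 0 \<le> av (g x)" by simp
  show "\<forall>\<^sub>F x in F. av (g x) \<le> h x" using assms(1) by simp
qed

text \<open>On \<open>'c\<close> the metric and the field operations are linked through
  \<open>is_Omega\<close>, so the limit laws are derived from the ultrametric inequality and the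
  multiplicativity of \<open>av\<close>.\<close>

lemma tendsto_add_av:
  assumes "(g \<longlongrightarrow> a) F" "(h \<longlongrightarrow> b) F"
  shows "((\<lambda>x. g x + h x :: 'c) \<longlongrightarrow> a + b) F"
proof -
  have lim: "((\<lambda>x. max (av (g x - a)) (av (h x - b))) \<longlongrightarrow> max 0 0) F"
    using assms by (intro tendsto_max) (simp_all add: tendsto_av_iff)
  have "\<forall>\<^sub>F x in F. av (g x + h x - (a + b)) \<le> max (av (g x - a)) (av (h x - b))"
    by (intro always_eventually allI) (metis add_diff_add av_ultra)
  then show ?thesis
    unfolding tendsto_av_iff
    by (rule tendsto_sandwich[OF _ _ tendsto_const, rotated]) (use lim in simp_all)
qed

lemma tendsto_cmult_av:
  assumes "(g \<longlongrightarrow> a) F"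
  shows "((\<lambda>x. b * g x :: 'c) \<longlongrightarrow> b * a) F"
proof -
  have "((\<lambda>x. av b * av (g x - a)) \<longlongrightarrow> av b * 0) F"
    using assms by (intro tendsto_mult tendsto_const) (simp add: tendsto_av_iff)
  then show ?thesis
    unfolding tendsto_av_iff by (simp add: right_diff_distrib flip: av_mult)
qed

lemma tendsto_diff_av:
  assumes "(g \<longlongrightarrow> a) F" "(h \<longlongrightarrow> b) F"
  shows "((\<lambda>x. g x - h x :: 'c) \<longlongrightarrow> a - b) F"
  using tendsto_add_av[OF assms(1) tendsto_cmult_av[OF assms(2), of "- 1"]] by simp

lemma tendsto_sum_av:
  assumes "\<And>i. i \<in> A \<Longrightarrow> (g i \<longlongrightarrow> a i) F"
  shows "((\<lambda>x. \<Sum>i\<in>A. g i x :: 'c) \<longlongrightarrow> (\<Sum>i\<in>A. a i)) F"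
  using assms
  by (induction A rule: infinite_finite_induct) (simp_all add: tendsto_add_av)

lemma sums_add_av: "g sums a \<Longrightarrow> h sums b \<Longrightarrow> (\<lambda>n. g n + h n :: 'c) sums (a + b)"
  unfolding sums_def by (simp add: sum.distrib tendsto_add_av)

lemma sums_cmult_av: "g sums a \<Longrightarrow> (\<lambda>n. b * g n :: 'c) sums (b * a)"
  unfolding sums_def by (simp add: tendsto_cmult_av flip: sum_distrib_left)

lemma sums_diff_av: "g sums a \<Longrightarrow> h sums b \<Longrightarrow> (\<lambda>n. g n - h n :: 'c) sums (a - b)"
  unfolding sums_def by (simp add: sum_subtractf tendsto_diff_av)

lemma av_lim_le:
  fixes g :: "nat \<Rightarrow> 'c"
  assumes "g \<longlonglongrightarrow> a" "\<forall>\<^sub>F n in sequentially. av (g n - b) \<le> B"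
  shows "av (a - b) \<le> B"
proof -
  have "(\<lambda>n. dist (g n) b) \<longlonglongrightarrow> dist a b"
    using assms(1) by (intro tendsto_dist tendsto_const)
  then show ?thesis
    using assms(2) by (intro tendsto_upperbound[of "\<lambda>n. av (g n - b)" _ sequentially]) (simp_all add: dist_av)
qed

lemma av_sums_le:
  fixes g :: "nat \<Rightarrow> 'c"
  assumes "g sums a" "\<And>n. av (g n) \<le> B"
  shows "av a \<le> B"
proof -
  have "B \<ge> 0" using assms(2)[of 0] av_nonneg[of "g 0"] by linarith
  then have "av (a - 0) \<le> B"
    using assms(2) by (intro av_lim_le[OF assms(1)[unfolded sums_def]]) (simp add: av_sum_le)
  then show ?thesis by simp
qed

lemma sum_diff_av:
  fixes g :: "nat \<Rightarrow> 'c"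
  assumes "\<And>n. n \<ge> N \<Longrightarrow> av (g n) \<le> B" "B \<ge> 0" "m \<ge> N"
  shows "av (sum g {..<m} - sum g {..<N}) \<le> B"
proof -
  have "sum g {..<m} - sum g {..<N} = sum g {N..<m}"
    using assms(3) by (simp add: sum_diff_nat_ivl lessThan_atLeast0)
  then show ?thesis using assms by (auto intro!: av_sum_le)
qed

text \<open>A block of consecutive terms is bounded by its largest term, so terms tending to 0
  already make the partial sums Cauchy.\<close>

lemma ultrametric_summable:
  fixes g :: "nat \<Rightarrow> 'c"
  assumes "(\<lambda>n. av (g n)) \<longlonglongrightarrow> 0"
  shows "\<exists>a. g sums a"
proof -
  have "Cauchy (\<lambda>n. sum g {..<n})"
  proof (rule metric_CauchyI)
    fix e :: real
    assume "e > 0"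
    then obtain N where N: "\<And>n. n \<ge> N \<Longrightarrow> av (g n) < e / 2"
      using order_tendstoD(2)[OF assms, of "e / 2"] by (auto simp: eventually_sequentially)
    have "dist (sum g {..<m}) (sum g {..<n}) < e" if "m \<ge> N" "n \<ge> N" for m n
    proof -
      have "av (sum g {..<i} - sum g {..<N}) \<le> e / 2" if "i \<ge> N" for i
        using that N \<open>e > 0\<close> by (intro sum_diff_av) (auto intro: less_imp_le)
      from av_diff_le[OF this[OF that(1)] this[OF that(2)]] show ?thesis
        using \<open>e > 0\<close> by (simp add: dist_av)
    qed
    then show "\<exists>M. \<forall>m\<ge>M. \<forall>n\<ge>M. dist (sum g {..<m}) (sum g {..<n}) < e" by blast
  qed
  then show ?thesis
    unfolding sums_def using Cauchy_convergent by (auto simp: convergent_def)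
qed

text \<open>A tail is controlled by its largest term instead of a sum of absolute values; the
  remainder estimates for expansions and for the new coefficients rest on this.\<close>

lemma ultrametric_tail_le:
  fixes g :: "nat \<Rightarrow> 'c"
  assumes "g sums a" "\<And>n. n \<ge> N \<Longrightarrow> av (g n) \<le> B"
  shows "av (a - sum g {..<N}) \<le> B"
proof (rule av_lim_le[OF assms(1)[unfolded sums_def]])
  have "B \<ge> 0" using assms(2)[of N] av_nonneg[of "g N"] by linarith
  then show "\<forall>\<^sub>F n in sequentially. av (sum g {..<n} - sum g {..<N}) \<le> B"
    using assms(2) by (intro eventually_sequentiallyI[of N] sum_diff_av) auto
qed

subsection \<open>Polynomials inside the completion\<close>

lemma iota_one: "\<iota> 1 = 1"
  and iota_add: "\<iota> (r + s) = \<iota> r + \<iota> s"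
  and iota_mult: "\<iota> (r * s) = \<iota> r * \<iota> s"
  and av_iota_Fract: "a \<noteq> 0 \<Longrightarrow> b \<noteq> 0 \<Longrightarrow>
        av (\<iota> (Fract a b)) = real CARD('f) powr (- (real \<delta> * (real (pi_order \<pi> a) - real (pi_order \<pi> b))))"
  using is_Omega unfolding is_Omega_def by (elim conjE, simp)+

lemma iota_zero: "\<iota> 0 = 0"
  using iota_add[of 0 0] by (metis add.right_neutral add_left_cancel)

lemma iota_minus: "\<iota> (- r) = - \<iota> r"
  using iota_add[of r "- r"] by (simp add: iota_zero eq_neg_iff_add_eq_0 add.commute)

lemma emb_zero [simp]: "emb \<iota> 0 = 0"
  by (simp add: emb_def iota_zero flip: Zero_fract_def)

lemma emb_one [simp]: "emb \<iota> 1 = 1"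
  by (simp add: emb_def iota_one flip: One_fract_def)

lemma emb_add: "emb \<iota> (a + b) = emb \<iota> a + emb \<iota> b"
  by (simp add: emb_def flip: iota_add)

lemma emb_mult: "emb \<iota> (a * b) = emb \<iota> a * emb \<iota> b"
  by (simp add: emb_def flip: iota_mult)

lemma emb_minus: "emb \<iota> (- a) = - emb \<iota> a"
  by (simp add: emb_def flip: iota_minus)

lemma emb_diff: "emb \<iota> (a - b) = emb \<iota> a - emb \<iota> b"
  using emb_add[of a "- b"] by (simp add: emb_minus)

lemma emb_power: "emb \<iota> (a ^ n) = emb \<iota> a ^ n"
  by (induction n) (simp_all add: emb_mult)

lemma emb_pCons: "emb \<iota> (pCons a p) = k a + \<xi> * emb \<iota> p"
proof -
  have "pCons a p = [:a:] + [:0, 1:] * p" by simp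
  then show ?thesis by (metis emb_add emb_mult xvar_def)
qed

lemma emb_monom: "emb \<iota> (Polynomial.monom a n) = k a * \<xi> ^ n"
  by (simp add: xvar_def flip: emb_power emb_mult)
     (simp add: Polynomial.monom_altdef)

lemma k_add: "k (a + b) = k a + k b"
  by (simp flip: emb_add)

lemma k_one [simp]: "k 1 = 1"
  by (metis emb_one one_pCons)

section \<open>The order at \<pi> and the absolute value of polynomials\<close>

text \<open>Since \<delta> > 0, the degree bounds the exponents, so the greatest one in
  \<open>pi_order\<close> exists.\<close>

lemma pi_power_dvd_degree: "\<pi> ^ n dvd a \<Longrightarrow> a \<noteq> 0 \<Longrightarrow> n \<le> Polynomial.degree a"
proof -
  assume "\<pi> ^ n dvd a" "a \<noteq> 0"
  then have "n * \<delta> \<le> Polynomial.degree a"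
    using dvd_imp_degree_le[of "\<pi> ^ n" a] monic_pi by (cases "\<pi> = 0") (auto simp: degree_power_eq)
  then show ?thesis
    using degree_pi_pos by (metis Suc_leI le_trans mult_le_mono2 mult.right_neutral One_nat_def)
qed

lemma pi_order_dvd: "a \<noteq> 0 \<Longrightarrow> \<pi> ^ pi_order \<pi> a dvd a"
  unfolding pi_order_def
  by (rule GreatestI_nat[where k = 0 and b = "Polynomial.degree a"])
     (auto intro: pi_power_dvd_degree)

lemma pi_power_dvd_iff: "a \<noteq> 0 \<Longrightarrow> \<pi> ^ n dvd a \<longleftrightarrow> n \<le> pi_order \<pi> a"
proof
  assume "a \<noteq> 0" "\<pi> ^ n dvd a"
  then show "n \<le> pi_order \<pi> a"
    unfolding pi_order_def
    by (intro Greatest_le_nat[where b = "Polynomial.degree a"]) (auto intro: pi_power_dvd_degree)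
next
  assume "a \<noteq> 0" "n \<le> pi_order \<pi> a"
  then show "\<pi> ^ n dvd a"
    using pi_order_dvd le_imp_power_dvd dvd_trans by blast
qed

lemma pi_order_one: "pi_order \<pi> 1 = 0"
  using pi_power_dvd_iff[of 1 "pi_order \<pi> 1"] pi_power_dvd_degree[of "pi_order \<pi> 1" 1] by simp

lemma powr_Q: "real CARD('f) powr (- (real \<delta> * real n)) = 1 / Q ^ n"
proof -
  have "real CARD('f) powr (- (real \<delta> * real n)) = 1 / real CARD('f) powr (real (\<delta> * n))"
    by (simp add: powr_minus_divide)
  also have "real CARD('f) powr (real (\<delta> * n)) = Q ^ n"
    using q_ge_2 by (subst powr_realpow) (simp_all add: power_mult)
  finally show ?thesis .
qed

lemma av_emb: "a \<noteq> 0 \<Longrightarrow> av (emb \<iota> a) = 1 / Q ^ pi_order \<pi> a"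
  unfolding emb_def by (subst av_iota_Fract) (simp_all add: pi_order_one powr_Q)

lemma av_emb_le_iff: "av (emb \<iota> a) \<le> 1 / Q ^ n \<longleftrightarrow> \<pi> ^ n dvd a"
proof (cases "a = 0")
  case True
  then show ?thesis using Q_pos by simp
next
  case False
  then show ?thesis
    using Q_gt_1 Q_pos by (simp add: av_emb pi_power_dvd_iff field_simps)
qed

lemma av_emb_le_1 [simp]: "av (emb \<iota> a) \<le> 1"
  using av_emb_le_iff[of a 0] by simp

lemma av_emb_eq_1: "\<not> \<pi> dvd a \<Longrightarrow> av (emb \<iota> a) = 1"
  using pi_power_dvd_iff[of a 1] by (cases "a = 0") (auto simp: av_emb not_less_eq_eq)

lemma av_xi_le_1 [simp]: "av \<xi> \<le> 1"
  by (simp add: xvar_def)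

lemma av_P: "av P = 1 / Q"
proof -
  have p0: "\<pi> \<noteq> 0" using monic_pi by auto
  have "\<not> \<pi> ^ 2 dvd \<pi>"
  proof
    assume "\<pi> ^ 2 dvd \<pi>"
    then have "\<pi> ^ 2 dvd \<pi> * 1" by simp
    then have "\<pi> dvd 1"
      unfolding power2_eq_square using p0 dvd_times_left_cancel_iff by blast
    then show False using irreducible_pi irreducible_not_unit by blast
  qed
  then have "pi_order \<pi> \<pi> = 1"
    using pi_power_dvd_iff[OF p0, of 1] pi_power_dvd_iff[OF p0, of 2] by simp
  then show ?thesis using av_emb[OF p0] by simp
qed

lemma k_nonzero: "a \<noteq> 0 \<Longrightarrow> k a \<noteq> 0"
proof -
  assume "a \<noteq> 0"
  then have "\<not> \<pi> dvd [:a:]"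
    using degree_pi_pos dvd_imp_degree_le[of \<pi> "[:a:]"] by auto
  then show ?thesis using av_emb_eq_1[of "[:a:]"] by auto
qed

lemma inj_k: "inj k"
proof (rule injI)
  fix a b assume "k a = k b"
  then have "k (a - b) = 0" using k_add[of "a - b" b] by (metis add_cancel_left_left diff_add_cancel)
  then show "a = b" using k_nonzero[of "a - b"] by (metis eq_iff_diff_eq_0)
qed

lemma k_power_q: "k a ^ CARD('f) = k a"
  by (simp add: finite_field_power_card poly_const_pow flip: emb_power)

subsection \<open>Frobenius and the additive polynomial of a line\<close>

lemma card_line: "z \<noteq> 0 \<Longrightarrow> card (range (\<lambda>a. k a * z)) = CARD('f)"
  by (rule card_image) (use inj_k in \<open>auto simp: inj_on_def\<close>)

text \<open>For fixed \<open>z \<noteq> 0\<close> both sides are monic polynomials of degree q in y.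
  They agree at the q points \<open>k a * z\<close>, because \<open>k (1 + a)\<close> equals its own
  q-th power; equal leading coefficients and q common values force equality.\<close>

lemma power_q_add: "(y + z :: 'c) ^ CARD('f) = y ^ CARD('f) + z ^ CARD('f)"
proof (cases "z = 0")
  case True
  then show ?thesis using q_ge_2 by (simp add: power_0_left)
next
  case False
  have "[:z, 1:] ^ CARD('f) = Polynomial.monom 1 CARD('f) + [:z ^ CARD('f):]"
  proof (rule poly_eqI_degree_lead_coeff[where n = "CARD('f)" and A = "range (\<lambda>a. k a * z)"])
    have "Polynomial.lead_coeff ([:z, 1:] ^ CARD('f)) = 1" by (simp add: lead_coeff_power)
    moreover have "poly.coeff [:z ^ CARD('f):] CARD('f) = 0" using q_ge_2 by (intro coeff_eq_0) simp
    ultimately show "poly.coeff ([:z, 1:] ^ CARD('f)) CARD('f) = poly.coeff (Polynomial.monom 1 CARD('f) + [:z ^ CARD('f):]) CARD('f)"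
      by (simp add: degree_linear_power)
    show "Polynomial.degree (Polynomial.monom 1 CARD('f) + [:z ^ CARD('f):]) \<le> CARD('f)"
      by (intro degree_add_le) (auto intro: degree_monom_le)
    show "CARD('f) \<le> card (range (\<lambda>a. k a * z))" using card_line[OF False] by simp
    fix w assume "w \<in> range (\<lambda>a. k a * z)"
    then obtain a where w: "w = k a * z" by blast
    have "k (1 + a) * z = z + w" by (simp add: w k_add algebra_simps)
    then have "(z + w) ^ CARD('f) = k (1 + a) * z ^ CARD('f)"
      by (metis k_power_q power_mult_distrib)
    then show "poly ([:z, 1:] ^ CARD('f)) w = poly (Polynomial.monom 1 CARD('f) + [:z ^ CARD('f):]) w"
      by (simp add: poly_monom w power_mult_distrib k_power_q k_add algebra_simps)
  qed (simp add: degree_linear_power)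
  from arg_cong[OF this, of "\<lambda>p. poly p y"] show ?thesis
    by (simp add: poly_monom add.commute)
qed

lemma power_q_minus: "(- y :: 'c) ^ CARD('f) = - (y ^ CARD('f))"
  using power_q_add[of y "- y"] q_ge_2 by (simp add: power_0_left eq_neg_iff_add_eq_0 add.commute)

lemma power_q_diff: "(y - z :: 'c) ^ CARD('f) = y ^ CARD('f) - z ^ CARD('f)"
  using power_q_add[of y "- z"] by (simp add: power_q_minus)

lemma power_qn_add: "(y + z :: 'c) ^ (CARD('f) ^ n) = y ^ (CARD('f) ^ n) + z ^ (CARD('f) ^ n)"
  by (induction n) (simp_all add: power_mult power_q_add mult.commute[of "CARD('f)"])

lemma k_power_qn: "k a ^ (CARD('f) ^ n) = k a"
  by (induction n) (simp_all add: power_mult k_power_q)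

text \<open>For \<open>z \<noteq> 0\<close>, the q points \<open>k a * z\<close> are roots of both
  monic polynomials of degree q in y.\<close>

lemma prod_line: "(\<Prod>a\<in>UNIV. y - k a * z) = y ^ CARD('f) - y * z ^ (CARD('f) - 1)"
proof (cases "z = 0")
  case True
  then show ?thesis using q_ge_2 by (simp add: power_0_left)
next
  case False
  have "(\<Prod>a\<in>UNIV. [:- (k a * z), 1:]) = Polynomial.monom 1 CARD('f) - [:0, z ^ (CARD('f) - 1):]"
  proof (rule poly_eqI_degree_lead_coeff[where n = "CARD('f)" and A = "range (\<lambda>a. k a * z)"])
    have deg: "Polynomial.degree (\<Prod>a\<in>UNIV. [:- (k a * z), 1:]) = CARD('f)"
      by (subst degree_prod_eq_sum_degree) simp_all
    have "Polynomial.lead_coeff (\<Prod>a\<in>UNIV. [:- (k a * z), 1:]) = 1"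
      by (simp add: lead_coeff_prod)
    moreover have "poly.coeff [:0, z ^ (CARD('f) - 1):] CARD('f) = 0"
      using q_ge_2 by (intro coeff_eq_0) (auto intro: le_less_trans[OF degree_pCons_le])
    ultimately show "poly.coeff (\<Prod>a\<in>UNIV. [:- (k a * z), 1:]) CARD('f)
        = poly.coeff (Polynomial.monom 1 CARD('f) - [:0, z ^ (CARD('f) - 1):]) CARD('f)"
      by (simp add: deg)
    show "Polynomial.degree (\<Prod>a\<in>UNIV. [:- (k a * z), 1:]) \<le> CARD('f)" using deg by simp
    show "Polynomial.degree (Polynomial.monom 1 CARD('f) - [:0, z ^ (CARD('f) - 1):]) \<le> CARD('f)"
      using q_ge_2 by (intro degree_diff_le) (auto intro: degree_monom_le le_trans[OF degree_pCons_le])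
    show "CARD('f) \<le> card (range (\<lambda>a. k a * z))" using card_line[OF False] by simp
    fix w assume "w \<in> range (\<lambda>a. k a * z)"
    then obtain a where w: "w = k a * z" by blast
    have "z ^ CARD('f) = z * z ^ (CARD('f) - 1)" using q_ge_2 by (metis power_eq_if not_numeral_le_zero)
    moreover have "(\<Prod>b\<in>UNIV. w - k b * z) = 0"
      by (rule prod_zero) (auto simp: w)
    ultimately show "poly (\<Prod>a\<in>UNIV. [:- (k a * z), 1:]) w = poly (Polynomial.monom 1 CARD('f) - [:0, z ^ (CARD('f) - 1):]) w"
      by (simp add: poly_monom poly_prod w power_mult_distrib k_power_q algebra_simps)
  qed
  from arg_cong[OF this, of "\<lambda>p. poly p y"] show ?thesis
    by (simp add: poly_monom poly_prod)
qed

subsection \<open>Brackets\<close>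

lemma bracket_emb: "br n = emb \<iota> (Polynomial.monom 1 (CARD('f) ^ n) - [:0, 1:])"
  by (simp add: bracket_def emb_diff emb_monom xvar_def)

lemma bracket_0 [simp]: "br 0 = 0"
  by (simp add: bracket_def)

lemma av_bracket_le_1 [simp]: "av (br n) \<le> 1"
  by (simp add: bracket_emb)

text \<open>\<open>x ^ q\<^sup>n - x\<close> is squarefree, its derivative being \<open>- 1\<close>.\<close>

lemma av_bracket_ge:
  assumes "n > 0"
  shows "1 / Q \<le> av (br n)"
proof -
  let ?p = "Polynomial.monom 1 (CARD('f) ^ n) - [:0, 1:] :: 'f poly"
  have "of_nat (CARD('f) ^ n) = (0 :: 'f)"
    using assms by (simp add: of_nat_card_finite_field power_0_left)
  then have deriv: "pderiv ?p = - 1"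
    by (simp add: pderiv_diff pderiv_monom pderiv_pCons one_pCons del: of_nat_power)
  have ndvd: "\<not> \<pi> ^ 2 dvd ?p"
  proof
    assume "\<pi> ^ 2 dvd ?p"
    then obtain r where "?p = \<pi> * (\<pi> * r)"
      unfolding power2_eq_square mult.assoc dvd_def by blast
    then have "- 1 = \<pi> * pderiv (\<pi> * r) + \<pi> * r * pderiv \<pi>"
      by (metis deriv pderiv_mult)
    then have "\<pi> dvd - 1"
      by (metis dvd_add dvd_triv_left mult.assoc)
    then have "\<pi> dvd 1" by simp
    then show False
      using irreducible_pi irreducible_not_unit by blast
  qed
  then have p0: "?p \<noteq> 0" by (metis dvd_0_right)
  with ndvd have "pi_order \<pi> ?p \<le> 1"
    using pi_power_dvd_iff[of ?p 2] by simp
  then have "Q ^ pi_order \<pi> ?p \<le> Q ^ 1"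
    using Q_gt_1 by (intro power_increasing) auto
  then have "1 / Q \<le> 1 / Q ^ pi_order \<pi> ?p"
    using Q_pos by (intro divide_left_mono) simp_all
  then show ?thesis
    by (simp only: bracket_emb av_emb[OF p0])
qed

lemma bracket_nonzero: "n > 0 \<Longrightarrow> br n \<noteq> 0"
  using av_bracket_ge[of n] Q_pos by (metis av_zero divide_pos_pos not_le zero_less_one)

lemma av_inverse_bracket_le: "n > 0 \<Longrightarrow> 1 / av (br n) \<le> Q"
proof -
  assume "n > 0"
  from av_bracket_ge[OF this] have "1 / av (br n) \<le> 1 / (1 / Q)"
    using Q_pos order.strict_trans2[OF _ av_bracket_ge[OF \<open>n > 0\<close>], of 0]
    by (intro divide_left_mono) simp_all
  then show ?thesis by simp
qed

subsection \<open>Carlitz polynomials\<close>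

text \<open>The zero polynomial is listed separately because its degree is 0; thus
  \<open>small_polys 0\<close> is {0} and \<open>e_poly\<close> is a product over
  \<open>small_polys i\<close> for every i.\<close>

definition small_polys :: "nat \<Rightarrow> 'f poly set" where
  "small_polys i = {\<omega>. \<omega> = 0 \<or> Polynomial.degree \<omega> < i}"

lemma small_polys_0 [simp]: "small_polys 0 = {0}"
  by (auto simp: small_polys_def)

lemma small_polys_coeff: "\<omega> \<in> small_polys i \<Longrightarrow> i \<le> n \<Longrightarrow> poly.coeff \<omega> n = 0"
  unfolding small_polys_def by (auto intro: coeff_eq_0)

lemma e_poly_prod: "e_poly \<iota> i t = (\<Prod>\<omega>\<in>small_polys i. t - emb \<iota> \<omega>)"
proof (cases "i = 0")
  case False
  then have "small_polys i = {\<omega>. Polynomial.degree \<omega> < i}"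
    by (auto simp: small_polys_def)
  with False show ?thesis by (simp add: e_poly_def)
qed (simp add: e_poly_def)

lemma bij_small_polys_Suc:
  "bij_betw (\<lambda>(a, \<omega>). Polynomial.monom a i + \<omega>) (UNIV \<times> small_polys i) (small_polys (Suc i))"
proof (rule bij_betw_byWitness[where f' = "\<lambda>\<omega>. (poly.coeff \<omega> i, \<omega> - Polynomial.monom (poly.coeff \<omega> i) i)"])
  show "\<forall>x\<in>UNIV \<times> small_polys i. (case (case x of (a, \<omega>) \<Rightarrow> Polynomial.monom a i + \<omega>) of \<omega> \<Rightarrow>
      (poly.coeff \<omega> i, \<omega> - Polynomial.monom (poly.coeff \<omega> i) i)) = x"
    by (auto simp: small_polys_coeff)
  show "(\<lambda>(a, \<omega>). Polynomial.monom a i + \<omega>) ` (UNIV \<times> small_polys i) \<subseteq> small_polys (Suc i)"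
    by (auto simp: small_polys_def less_Suc_eq_le degree_monom_le intro!: degree_add_le)
  show "(\<lambda>\<omega>. (poly.coeff \<omega> i, \<omega> - Polynomial.monom (poly.coeff \<omega> i) i)) ` small_polys (Suc i)
      \<subseteq> UNIV \<times> small_polys i"
  proof clarsimp
    fix \<omega> assume \<omega>: "\<omega> \<in> small_polys (Suc i)"
    have "Polynomial.degree (\<omega> - Polynomial.monom (poly.coeff \<omega> i) i) \<le> i"
      using \<omega> by (intro degree_diff_le) (auto simp: small_polys_def degree_monom_le)
    then show "\<omega> - Polynomial.monom (poly.coeff \<omega> i) i \<in> small_polys i"
      unfolding small_polys_def
      using eq_zero_or_degree_less[of "\<omega> - Polynomial.monom (poly.coeff \<omega> i) i" i] by simp
  qed
qed auto

lemma finite_small_polys: "finite (small_polys i)"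
proof (induction i)
  case (Suc i)
  then show ?case
    using bij_betw_finite[OF bij_small_polys_Suc[of i]] by simp
qed simp

lemma e_poly_0 [simp]: "e_poly \<iota> 0 t = t"
  by (simp add: e_poly_def)

text \<open>The factors of e_(i+1) are grouped by the coefficient of x^i in \<omega>.\<close>

lemma e_poly_Suc_prod: "e_poly \<iota> (Suc i) t = (\<Prod>a\<in>UNIV. e_poly \<iota> i (t - k a * \<xi> ^ i))"
proof -
  have "e_poly \<iota> (Suc i) t
      = (\<Prod>x\<in>UNIV \<times> small_polys i. t - emb \<iota> (case x of (a, \<omega>) \<Rightarrow> Polynomial.monom a i + \<omega>))"
    unfolding e_poly_prod by (rule prod.reindex_bij_betw[OF bij_small_polys_Suc, symmetric])
  also have "\<dots> = (\<Prod>a\<in>UNIV. \<Prod>\<omega>\<in>small_polys i. t - emb \<iota> (Polynomial.monom a i + \<omega>))"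
    by (subst prod.cartesian_product) (simp add: case_prod_unfold)
  finally show ?thesis
    by (simp add: e_poly_prod emb_add emb_monom diff_diff_eq)
qed

text \<open>The claims need a joint induction. Linearity of e_i turns the factors of e_(i+1) into
  e_i(t) - a e_i(x^i), whose product over a is given by \<open>prod_line\<close>; the resulting
  recursion and the additivity of the q-th power pass linearity on to e_(i+1).\<close>

lemma e_poly_linear_Suc:
  "(\<forall>y z. e_poly \<iota> i (y + z) = e_poly \<iota> i y + e_poly \<iota> i z) \<and>
   (\<forall>a y. e_poly \<iota> i (k a * y) = k a * e_poly \<iota> i y) \<and>
   (\<forall>t. e_poly \<iota> (Suc i) t = e_poly \<iota> i t ^ CARD('f) - e_poly \<iota> i (\<xi> ^ i) ^ (CARD('f) - 1) * e_poly \<iota> i t)"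
proof (induction i)
  case 0
  show ?case by (simp add: algebra_simps e_poly_Suc_prod prod_line[of _ 1, simplified])
next
  case (Suc i)
  let ?e = "e_poly \<iota> (Suc i)"
  have add: "?e (y + z) = ?e y + ?e z" for y z
    using Suc by (simp only: power_q_add distrib_left) (simp add: algebra_simps)
  have hom: "?e (k a * y) = k a * ?e y" for a y
    using Suc by (simp only: power_mult_distrib k_power_q right_diff_distrib) (simp add: algebra_simps)
  have minus: "?e (y - z) = ?e y - ?e z" for y z
    using add[of "y - z" z] by (simp add: algebra_simps)
  have "e_poly \<iota> (Suc (Suc i)) t = ?e t ^ CARD('f) - ?e (\<xi> ^ Suc i) ^ (CARD('f) - 1) * ?e t" for t
    unfolding e_poly_Suc_prod[of "Suc i"] by (simp only: minus hom prod_line mult.commute)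
  with add hom show ?case by blast
qed

lemma e_poly_add: "e_poly \<iota> i (y + z) = e_poly \<iota> i y + e_poly \<iota> i z"
  and e_poly_k: "e_poly \<iota> i (k a * y) = k a * e_poly \<iota> i y"
  and e_poly_Suc: "e_poly \<iota> (Suc i) t = e_poly \<iota> i t ^ CARD('f) - e_poly \<iota> i (\<xi> ^ i) ^ (CARD('f) - 1) * e_poly \<iota> i t"
  using e_poly_linear_Suc by auto

lemma power_q_eq: "(y :: 'c) ^ CARD('f) = y ^ (CARD('f) - 1) * y"
  using q_ge_2 by (metis mult.commute power_eq_if not_numeral_le_zero)

lemma e_poly_vanish: "e_poly \<iota> (Suc i) (\<xi> ^ i) = 0"
  by (simp only: e_poly_Suc power_q_eq[of "e_poly \<iota> i _"] diff_self)

lemma D_seq_0 [simp]: "D_seq \<iota> 0 = 1"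
  by (simp add: D_seq_def)

lemma D_seq_Suc: "D_seq \<iota> (Suc i) = br (Suc i) * D_seq \<iota> i ^ CARD('f)"
proof -
  have "(\<Prod>j = 1..i. br j ^ (CARD('f) ^ (Suc i - j))) = (\<Prod>j = 1..i. br j ^ (CARD('f) ^ (i - j))) ^ CARD('f)"
    unfolding prod_power_distrib
    by (intro prod.cong) (auto simp: Suc_diff_le power_mult mult.commute[of "CARD('f)"])
  then show ?thesis
    by (simp add: D_seq_def mult.commute)
qed

text \<open>Again a joint induction. Putting t = x^i into the shift formula and using e_(i+1)(x^i) =
  0 yields the value D_(i+1) at x^(i+1); this value makes the recursion for e_(i+2) explicit, and
  the next shift formula follows from it.\<close>

lemma e_poly_shift_D:
  "(\<forall>t. e_poly \<iota> (Suc i) (\<xi> * t) = \<xi> * e_poly \<iota> (Suc i) t + br (Suc i) * e_poly \<iota> i t ^ CARD('f)) \<and>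
   e_poly \<iota> i (\<xi> ^ i) = D_seq \<iota> i"
proof (induction i)
  case 0
  show ?case
    by (simp add: e_poly_Suc bracket_def power_mult_distrib algebra_simps)
next
  case (Suc i)
  have "e_poly \<iota> (Suc i) (\<xi> ^ Suc i) = br (Suc i) * D_seq \<iota> i ^ CARD('f)"
    using Suc e_poly_vanish[of i] by simp
  then have D: "e_poly \<iota> (Suc i) (\<xi> ^ Suc i) = D_seq \<iota> (Suc i)"
    by (simp add: D_seq_Suc)
  have "e_poly \<iota> (Suc (Suc i)) (\<xi> * t) = \<xi> * e_poly \<iota> (Suc (Suc i)) t + br (Suc (Suc i)) * e_poly \<iota> (Suc i) t ^ CARD('f)" for t
  proof -
    let ?b = "br (Suc i)" and ?D = "D_seq \<iota> i" and ?e = "e_poly \<iota> i t" and ?e' = "e_poly \<iota> (Suc i) t"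
    let ?D' = "D_seq \<iota> (Suc i)"
    have e': "?e' = ?e ^ CARD('f) - ?D ^ (CARD('f) - 1) * ?e"
      using Suc by (simp add: e_poly_Suc)
    have bq: "?b ^ CARD('f) = \<xi> ^ (CARD('f) ^ Suc (Suc i)) - \<xi> ^ CARD('f)"
      by (simp add: bracket_def power_q_diff mult.commute flip: power_mult)
    have D': "?D' ^ (CARD('f) - 1) * ?b = ?b ^ CARD('f) * (?D ^ CARD('f)) ^ (CARD('f) - 1)"
      by (simp add: D_seq_Suc power_mult_distrib power_q_eq[of ?b] algebra_simps)
    have comm: "(?D ^ CARD('f)) ^ (CARD('f) - 1) = (?D ^ (CARD('f) - 1)) ^ CARD('f)"
      by (metis mult.commute power_mult)
    have "e_poly \<iota> (Suc (Suc i)) (\<xi> * t) = (\<xi> * ?e' + ?b * ?e ^ CARD('f)) ^ CARD('f) - ?D' ^ (CARD('f) - 1) * (\<xi> * ?e' + ?b * ?e ^ CARD('f))"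
      using Suc D by (subst e_poly_Suc) simp
    also have "\<dots> = \<xi> ^ CARD('f) * ?e' ^ CARD('f) + ?b ^ CARD('f) * (?e ^ CARD('f)) ^ CARD('f) - ?D' ^ (CARD('f) - 1) * \<xi> * ?e'
        - (?D' ^ (CARD('f) - 1) * ?b) * ?e ^ CARD('f)"
      by (simp add: power_q_add power_mult_distrib algebra_simps)
    also have "\<dots> = \<xi> ^ CARD('f) * ?e' ^ CARD('f) - ?D' ^ (CARD('f) - 1) * \<xi> * ?e' + ?b ^ CARD('f) * ((?e ^ CARD('f)) ^ CARD('f) - (?D ^ CARD('f)) ^ (CARD('f) - 1) * ?e ^ CARD('f))"
      unfolding D' by (simp add: algebra_simps)
    \<comment> \<open>This is the recursion for e_(i+1), raised to the q-th power.\<close>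
    also have "(?e ^ CARD('f)) ^ CARD('f) - (?D ^ CARD('f)) ^ (CARD('f) - 1) * ?e ^ CARD('f) = ?e' ^ CARD('f)"
      by (simp only: e' comm power_q_diff power_mult_distrib)
    \<comment> \<open>The coefficients of the q-th power of \<open>?e'\<close> combine by x^q +
      [i+1]^q = x^(q^(i+2)) = x + [i+2].\<close>
    also have "\<xi> ^ CARD('f) * ?e' ^ CARD('f) - ?D' ^ (CARD('f) - 1) * \<xi> * ?e' + ?b ^ CARD('f) * ?e' ^ CARD('f)
        = \<xi> * (?e' ^ CARD('f) - ?D' ^ (CARD('f) - 1) * ?e') + br (Suc (Suc i)) * ?e' ^ CARD('f)"
      by (simp add: bq bracket_def[of _ "Suc (Suc i)"] algebra_simps del: power_Suc)
    also have "?e' ^ CARD('f) - ?D' ^ (CARD('f) - 1) * ?e' = e_poly \<iota> (Suc (Suc i)) t"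
      using D by (subst (3) e_poly_Suc) simp
    finally show ?thesis .
  qed
  with D show ?case by blast
qed

lemma e_poly_shift: "e_poly \<iota> (Suc i) (\<xi> * t) = \<xi> * e_poly \<iota> (Suc i) t + br (Suc i) * e_poly \<iota> i t ^ CARD('f)"
  and e_poly_power: "e_poly \<iota> i (\<xi> ^ i) = D_seq \<iota> i"
  using e_poly_shift_D by auto

lemma D_seq_nonzero: "D_seq \<iota> i \<noteq> 0"
  by (induction i) (simp_all add: D_seq_Suc bracket_nonzero)

lemma D_seq_prod: "D_seq \<iota> i = (\<Prod>\<omega>\<in>small_polys i. emb \<iota> (Polynomial.monom 1 i - \<omega>))"
  unfolding e_poly_power[symmetric] e_poly_prod by (simp add: emb_diff emb_monom)

text \<open>\<open>D\<^sub>i\<close> is the product of all monic polynomials of degree \<open>i\<close>; hence \<open>D\<^bsub>\<delta>-1\<^esub>\<close> is a unit, while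
  \<open>\<pi>\<close> divides \<open>D\<^sub>\<delta> = [\<delta>] D\<^bsub>\<delta>-1\<^esub>\<^sup>q\<close>.\<close>

lemma av_bracket_degree: "av (br \<delta>) \<le> 1 / Q"
proof -
  obtain m where m: "\<delta> = Suc m"
    using degree_pi_pos gr0_conv_Suc by blast
  have "av (emb \<iota> (Polynomial.monom 1 m - \<omega>)) = 1" if "\<omega> \<in> small_polys m" for \<omega>
  proof (rule av_emb_eq_1)
    let ?p = "Polynomial.monom 1 m - \<omega>"
    have "poly.coeff ?p m = 1" using that by (simp add: small_polys_coeff)
    then have "?p \<noteq> 0" by auto
    moreover have "Polynomial.degree ?p \<le> m"
      using that by (intro degree_diff_le) (auto simp: small_polys_def degree_monom_le)
    ultimately show "\<not> \<pi> dvd ?p"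
      using dvd_imp_degree_le[of \<pi> ?p] m by auto
  qed
  then have 1: "av (D_seq \<iota> m) = 1"
    by (simp add: D_seq_prod av_prod)
  \<comment> \<open>\<open>?w\<close> is the index whose factor is \<pi> itself; that factor
    contributes 1 / Q, and all others are integral.\<close>
  let ?w = "Polynomial.monom 1 \<delta> - \<pi>"
  have "Polynomial.degree ?w \<le> \<delta>" by (intro degree_diff_le) (auto simp: degree_monom_le)
  then have w: "?w \<in> small_polys \<delta>"
    using monic_pi eq_zero_or_degree_less[of ?w \<delta>] by (simp add: small_polys_def)
  have "D_seq \<iota> \<delta> = P * (\<Prod>\<omega>\<in>small_polys \<delta> - {?w}. emb \<iota> (Polynomial.monom 1 \<delta> - \<omega>))"
    unfolding D_seq_prod by (subst prod.remove[OF finite_small_polys w]) simp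
  moreover have "(\<Prod>\<omega>\<in>small_polys \<delta> - {?w}. av (emb \<iota> (Polynomial.monom 1 \<delta> - \<omega>))) \<le> 1"
    by (intro prod_le_1) auto
  ultimately have "av (D_seq \<iota> \<delta>) \<le> 1 / Q * 1"
    using Q_pos by (simp only: av_mult av_P av_prod) (intro mult_left_mono, auto)
  then show ?thesis
    by (simp add: m D_seq_Suc av_mult av_power 1)
qed

lemma f_poly_0 [simp]: "f_poly \<iota> 0 t = t"
  by (simp add: f_poly_def)

lemma f_poly_add: "f_poly \<iota> i (y + z) = f_poly \<iota> i y + f_poly \<iota> i z"
  by (simp add: f_poly_def e_poly_add distrib_left)

lemma f_poly_k: "f_poly \<iota> i (k a * y) = k a * f_poly \<iota> i y"
  by (simp add: f_poly_def e_poly_k)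

lemma f_poly_zero [simp]: "f_poly \<iota> i 0 = 0"
  using f_poly_k[of i 0 0] by simp

text \<open>Because e_i(x^i) = D_i and D_(i+1) = [i+1] D_i^q, the normalization reduces both
  coefficients of the recursion to 1 / [i+1], up to sign.\<close>

lemma f_poly_Suc: "f_poly \<iota> (Suc i) t = (f_poly \<iota> i t ^ CARD('f) - f_poly \<iota> i t) / br (Suc i)"
  using D_seq_nonzero[of i] bracket_nonzero[of "Suc i"]
  by (simp add: f_poly_def e_poly_Suc e_poly_power D_seq_Suc power_mult_distrib power_inverse
      power_q_eq[of "D_seq \<iota> i"] divide_simps)

lemma f_poly_shift: "f_poly \<iota> (Suc i) (\<xi> * t) = \<xi> * f_poly \<iota> (Suc i) t + f_poly \<iota> i t ^ CARD('f)"
  using D_seq_nonzero[of i] bracket_nonzero[of "Suc i"]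
  by (simp add: f_poly_def e_poly_shift D_seq_Suc power_mult_distrib distrib_left power_inverse)

lemma Delta_f_poly_0: "Delta_op \<iota> (f_poly \<iota> 0) t = 0"
  by (simp add: Delta_op_def)

lemma Delta_f_poly_Suc:
  "Delta_op \<iota> (f_poly \<iota> (Suc i)) t = br (Suc i) * f_poly \<iota> (Suc i) t + f_poly \<iota> i t"
proof -
  have "br (Suc i) * f_poly \<iota> (Suc i) t = f_poly \<iota> i t ^ CARD('f) - f_poly \<iota> i t"
    using bracket_nonzero[of "Suc i"] by (simp add: f_poly_Suc)
  then show ?thesis by (simp add: Delta_op_def f_poly_shift)
qed

lemma f_poly_one: "f_poly \<iota> (Suc i) 1 = 0"
proof (induction i)
  case 0
  show ?case by (simp add: f_poly_Suc)
next
  case (Suc i)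
  then show ?case using q_ge_2 by (subst f_poly_Suc) (simp add: power_0_left)
qed

text \<open>While f_i(t) is integral, its q-th power is no larger than f_i(t) itself, so only the
  division by the bracket can enlarge the value.\<close>

lemma av_f_poly_Suc:
  assumes "av (f_poly \<iota> i t) \<le> 1"
  shows "av (f_poly \<iota> (Suc i) t) \<le> Q * av (f_poly \<iota> i t)"
proof -
  let ?a = "av (f_poly \<iota> i t)"
  have "?a ^ CARD('f) \<le> ?a ^ 1"
    using assms q_ge_2 by (intro power_decreasing) auto
  then have "av (f_poly \<iota> i t ^ CARD('f) - f_poly \<iota> i t) \<le> ?a"
    by (intro av_diff_le) (auto simp: av_power)
  then have "av (f_poly \<iota> (Suc i) t) \<le> ?a * (1 / av (br (Suc i)))"
    by (simp add: f_poly_Suc av_divide divide_right_mono)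
  also have "\<dots> \<le> ?a * Q"
    by (intro mult_left_mono av_inverse_bracket_le) auto
  finally show ?thesis by (simp add: mult.commute)
qed

text \<open>On the ball of radius Q^(-i) the values f_j(y) with j < i stay integral, so
  \<open>av_f_poly_Suc\<close> can be iterated before integrality on all of
  \<open>O\<^sub>\<pi>\<close> is known; the proof of that integrality relies on this bound.\<close>

lemma av_f_poly_small: "av y \<le> 1 / Q ^ i \<Longrightarrow> av (f_poly \<iota> i y) \<le> Q ^ i * av y"
proof (induction i)
  case (Suc i)
  have "1 / Q ^ Suc i \<le> 1 / Q ^ i"
    using Q_gt_1 by (intro divide_left_mono power_increasing) auto
  with Suc have le: "av (f_poly \<iota> i y) \<le> Q ^ i * av y" and y: "av y \<le> 1 / Q ^ i" by auto
  have "Q ^ i * av y \<le> 1"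
    using y Q_pos by (simp add: pos_le_divide_eq mult.commute)
  with le have "av (f_poly \<iota> (Suc i) y) \<le> Q * av (f_poly \<iota> i y)"
    by (intro av_f_poly_Suc) simp
  also have "\<dots> \<le> Q * (Q ^ i * av y)"
    using le Q_pos by (intro mult_left_mono) auto
  finally show ?case by (simp add: mult.assoc)
qed simp

text \<open>Horner's scheme: the shift formula expresses f_i at x p through values at p, and at
  constants only f_0 can be nonzero.\<close>

lemma av_f_poly_emb: "av (f_poly \<iota> i (emb \<iota> p)) \<le> 1"
proof (induction p arbitrary: i)
  case (pCons a p)
  have 1: "av (f_poly \<iota> i 1) \<le> 1" for i
    by (cases i) (simp_all add: f_poly_one)
  have "av (f_poly \<iota> i (\<xi> * emb \<iota> p)) \<le> 1"
  proof (cases i)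
    case 0
    then show ?thesis by (simp add: av_mult mult_le_one)
  next
    case (Suc j)
    show ?thesis
      unfolding Suc f_poly_shift
      by (intro av_add_le) (simp_all add: av_mult av_power pCons.IH mult_le_one power_le_one)
  qed
  moreover have "av (f_poly \<iota> i (k a * 1)) \<le> 1"
    unfolding f_poly_k by (simp add: av_mult mult_le_one 1 del: mult_1_right)
  ultimately show ?case
    by (subst emb_pCons) (simp add: f_poly_add av_add_le)
qed simp

subsection \<open>The ring of integers\<close>

lemma K_set_iff: "t \<in> K\<^sub>\<pi> \<longleftrightarrow> (\<forall>e>0. \<exists>r. av (t - \<iota> r) < e)"
  by (simp add: K_set_def closure_approachable dist_av av_diff_commute[of _ t])

lemma K_set_add:
  assumes "s \<in> K\<^sub>\<pi>" "t \<in> K\<^sub>\<pi>"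
  shows "s + t \<in> K\<^sub>\<pi>"
  unfolding K_set_iff
proof (intro allI impI)
  fix e :: real assume "e > 0"
  with assms obtain r r' where "av (s - \<iota> r) < e" "av (t - \<iota> r') < e"
    unfolding K_set_iff by blast
  moreover have "s + t - \<iota> (r + r') = (s - \<iota> r) + (t - \<iota> r')"
    by (simp add: iota_add)
  ultimately have "av (s + t - \<iota> (r + r')) < e"
    by (metis av_ultra le_less_trans max_less_iff_conj)
  then show "\<exists>r. av (s + t - \<iota> r) < e" by blast
qed

lemma K_set_iota_mult:
  assumes "t \<in> K\<^sub>\<pi>"
  shows "\<iota> s * t \<in> K\<^sub>\<pi>"
  unfolding K_set_iff
proof (intro allI impI)
  fix e :: real assume "e > 0"
  have c: "av (\<iota> s) + 1 > 0" using av_nonneg[of "\<iota> s"] by linarith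
  with \<open>e > 0\<close> assms obtain r where r: "av (t - \<iota> r) < e / (av (\<iota> s) + 1)"
    unfolding K_set_iff by (meson divide_pos_pos)
  have "av (\<iota> s * t - \<iota> (s * r)) = av (\<iota> s) * av (t - \<iota> r)"
    by (simp add: iota_mult right_diff_distrib flip: av_mult)
  also have "\<dots> \<le> (av (\<iota> s) + 1) * av (t - \<iota> r)"
    by (intro mult_right_mono) auto
  also have "\<dots> < e" using r c by (simp add: pos_less_divide_eq mult.commute)
  finally show "\<exists>r. av (\<iota> s * t - \<iota> r) < e" by blast
qed

lemma iota_in_K_set [simp]: "\<iota> r \<in> K\<^sub>\<pi>"
  using closure_subset[of "range \<iota>"] by (auto simp: K_set_def)

lemma emb_in_O_set [simp]: "emb \<iota> p \<in> O\<^sub>\<pi>"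
  by (simp add: O_set_def) (simp add: emb_def)

lemma one_in_O_set [simp]: "1 \<in> O\<^sub>\<pi>"
  using emb_in_O_set[of 1] by (simp only: emb_one)

lemma P_power_in_O_set [simp]: "P ^ n \<in> O\<^sub>\<pi>"
  by (simp flip: emb_power)

lemma O_set_add [intro]: "s \<in> O\<^sub>\<pi> \<Longrightarrow> t \<in> O\<^sub>\<pi> \<Longrightarrow> s + t \<in> O\<^sub>\<pi>"
  by (simp add: O_set_def K_set_add av_add_le)

lemma O_set_emb_mult [intro]: "t \<in> O\<^sub>\<pi> \<Longrightarrow> emb \<iota> p * t \<in> O\<^sub>\<pi>"
  by (simp add: O_set_def av_mult mult_le_one) (simp add: emb_def K_set_iota_mult)

lemma O_set_xi_mult [intro]: "t \<in> O\<^sub>\<pi> \<Longrightarrow> \<xi> * t \<in> O\<^sub>\<pi>"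
  unfolding xvar_def by (rule O_set_emb_mult)

lemma O_set_diff_emb: "t \<in> O\<^sub>\<pi> \<Longrightarrow> t - emb \<iota> p \<in> O\<^sub>\<pi>"
  by (metis O_set_add emb_in_O_set emb_minus add_uminus_conv_diff)

lemma P_nonzero: "P \<noteq> 0"
  using av_P Q_pos by auto

lemma divide_P_in_O_set:
  assumes "t \<in> K\<^sub>\<pi>" "av t \<le> 1 / Q"
  shows "t / P \<in> O\<^sub>\<pi>"
proof -
  have "\<pi> \<noteq> 0" using monic_pi by auto
  then have "Fract 1 \<pi> * Fract \<pi> 1 = 1"
    by (simp add: eq_fract One_fract_def)
  then have "\<iota> (Fract 1 \<pi>) * P = 1"
    by (metis emb_def iota_one iota_mult)
  then have "t / P = \<iota> (Fract 1 \<pi>) * t"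
    using P_nonzero by (simp add: field_simps)
  moreover have "av (t / P) \<le> 1"
    using assms(2) Q_pos by (simp add: av_divide av_P pos_le_divide_eq)
  ultimately show ?thesis
    using K_set_iota_mult[OF assms(1)] by (simp add: O_set_def)
qed

section \<open>Density of the polynomials and the kernel of \<Delta>\<close>

text \<open>Euclidean descent: b is replaced by \<open>\<pi> mod b\<close> or
  \<open>b mod \<pi>\<close>, of smaller degree, until it is constant. In the first case
  irreducibility of \<pi> keeps the remainder nonzero.\<close>

lemma inverse_mod_pi:
  assumes "\<not> \<pi> dvd b"
  shows "\<exists>u. \<pi> dvd 1 - u * b"
  using assms
proof (induction "Polynomial.degree b" arbitrary: b rule: less_induct)
  case less
  then have b0: "b \<noteq> 0" by auto
  show ?case
  proof (cases "Polynomial.degree b = 0")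
    case True
    then obtain c where "b = [:c:]" by (rule degree_eq_zeroE)
    with b0 have "1 - [:inverse c:] * b = 0" by (simp add: one_pCons)
    then show ?thesis by (metis dvd_0_right)
  next
    case pos: False
    show ?thesis
    proof (cases "Polynomial.degree b < \<delta>")
      case True
      let ?r = "\<pi> mod b"
      have "?r \<noteq> 0"
      proof
        assume "?r = 0"
        then have "b dvd \<pi>" by auto
        then obtain c where c: "\<pi> = b * c" by blast
        have "\<not> b dvd 1" using pos by (auto simp: is_unit_iff_degree b0)
        then have "c dvd 1" using Factorial_Ring.irreducibleD[OF irreducible_pi c] by blast
        then have "Polynomial.degree c = 0" 
          by (metis dvd_0_left is_unit_iff_degree zero_neq_one)
        then have "\<delta> \<le> Polynomial.degree b"
          unfolding c using degree_mult_le[of b c] by simp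
        with True show False by simp
      qed
      then have deg: "Polynomial.degree ?r < Polynomial.degree b"
        using degree_mod_less[OF b0] by blast
      then have "\<not> \<pi> dvd ?r"
        using True \<open>?r \<noteq> 0\<close> dvd_imp_degree_le[of \<pi> ?r] by auto
      then obtain u where "\<pi> dvd 1 - u * ?r"
        using less.hyps[OF deg] by blast
      \<comment> \<open>Adding a multiple of \<pi> turns the inverse of the remainder into an
        inverse of b.\<close>
      then have "\<pi> dvd 1 - u * ?r + \<pi> * u" by simp
      also have "1 - u * ?r + \<pi> * u = 1 - (- u * (\<pi> div b)) * b"
        by (simp add: algebra_simps flip: minus_div_mult_eq_mod)
      finally show ?thesis by blast
    next
      case False
      let ?r = "b mod \<pi>"
      have "\<not> \<pi> dvd ?r" using less.prems by (simp add: dvd_mod_iff)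
      moreover from this have "?r \<noteq> 0" by auto
      then have deg: "Polynomial.degree ?r < Polynomial.degree b"
        using False degree_mod_less[of \<pi> b] degree_pi_pos by fastforce
      ultimately obtain u where "\<pi> dvd 1 - u * ?r"
        using less.hyps by blast
      then have "\<pi> dvd 1 - u * ?r - \<pi> * (u * (b div \<pi>))" by simp
      also have "1 - u * ?r - \<pi> * (u * (b div \<pi>)) = 1 - u * b"
        by (simp add: algebra_simps flip: minus_div_mult_eq_mod)
      finally show ?thesis by blast
    qed
  qed
qed

text \<open>The n-th power of \<open>1 - u * b\<close> is divisible by \<pi>^n and is again 1 minus
  a multiple of b.\<close>

lemma inverse_mod_pi_power:
  assumes "\<not> \<pi> dvd b"
  shows "\<exists>u. \<pi> ^ n dvd 1 - u * b"
proof -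
  obtain u where u: "\<pi> dvd 1 - u * b" using inverse_mod_pi[OF assms] by blast
  have "\<exists>v. (1 - u * b) ^ n = 1 - v * b" for n
  proof (induction n)
    case 0
    show ?case by (intro exI[of _ 0]) simp
  next
    case (Suc n)
    then obtain v where "(1 - u * b) ^ n = 1 - v * b" by blast
    then have "(1 - u * b) ^ Suc n = (1 - u * b) * (1 - v * b)" by simp
    also have "\<dots> = 1 - (u + v - u * b * v) * b"
      by (simp add: algebra_simps)
    finally have "(1 - u * b) ^ Suc n = 1 - (u + v - u * b * v) * b" .
    then show ?case by blast
  qed
  then show ?thesis
    using dvd_power_same[OF u, of n] by metis
qed

text \<open>A fraction approximates t; its integrality lets the powers of \<pi> in the denominator
  cancel, and the remaining denominator is inverted modulo a high power of \<pi>.\<close>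

lemma emb_dense:
  assumes "t \<in> O\<^sub>\<pi>" "e > 0"
  shows "\<exists>p. av (t - emb \<iota> p) < e"
proof -
  have t: "t \<in> K\<^sub>\<pi>" "av t \<le> 1" using assms(1) by (auto simp: O_set_def)
  \<comment> \<open>The cap 1 makes the approximating fraction integral as well.\<close>
  have "min e 1 > 0" using assms(2) by simp
  with t obtain r where r: "av (t - \<iota> r) < min e 1"
    unfolding K_set_iff by blast
  then have r1: "av (\<iota> r) \<le> 1"
    using av_diff[of t "t - \<iota> r"] t(2) by (simp add: max_def split: if_splits)
  obtain a b where ab: "r = Fract a b" "b \<noteq> 0" by (cases r)
  have "\<exists>p. av (\<iota> r - emb \<iota> p) < e"
  proof (cases "a = 0")
    case True
    then have "r = Fract 0 1" using ab by (simp add: eq_fract)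
    then have "\<iota> r = emb \<iota> 0" by (simp only: emb_def)
    then show ?thesis using assms(2) by (intro exI[of _ 0]) simp
  next
    case False
    let ?m = "pi_order \<pi> b"
    obtain b' where b': "b = \<pi> ^ ?m * b'"
      using pi_order_dvd[OF ab(2)] by blast
    have "\<not> \<pi> dvd b'"
    proof
      assume "\<pi> dvd b'"
      then have "\<pi> ^ ?m * \<pi> dvd \<pi> ^ ?m * b'" by (rule mult_dvd_mono[OF dvd_refl])
      then have "\<pi> ^ Suc ?m dvd b" unfolding b'[symmetric] by (simp only: power_Suc2)
      then show False using pi_power_dvd_iff[OF ab(2), of "Suc ?m"] by simp
    qed
    have "r * Fract b 1 = Fract a 1"
      using ab(2) by (simp add: ab eq_fract)
    then have emb_b: "\<iota> r * emb \<iota> b = emb \<iota> a"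
      by (metis emb_def iota_mult)
    have "av (emb \<iota> a) = av (\<iota> r) * (1 / Q ^ ?m)"
      unfolding emb_b[symmetric] av_mult av_emb[OF ab(2)] ..
    also have "\<dots> \<le> 1 * (1 / Q ^ ?m)" using r1 Q_pos by (intro mult_right_mono) auto
    finally have "\<pi> ^ ?m dvd a" by (simp add: av_emb_le_iff)
    then obtain a' where a': "a = \<pi> ^ ?m * a'" by blast
    have "\<iota> r * (emb \<iota> b' * emb \<iota> (\<pi> ^ ?m)) = emb \<iota> a' * emb \<iota> (\<pi> ^ ?m)"
      using emb_b unfolding emb_mult[symmetric] mult.commute[of _ "\<pi> ^ ?m"] a'[symmetric] b'[symmetric] .
    then have ra: "\<iota> r * emb \<iota> b' = emb \<iota> a'"
      using P_nonzero by (simp add: emb_power)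
    obtain n where n: "1 / Q ^ n < e"
      using real_arch_pow_inv[OF assms(2), of "1 / Q"] Q_gt_1 by (auto simp: power_one_over)
    obtain u where u: "\<pi> ^ n dvd 1 - u * b'"
      using inverse_mod_pi_power[OF \<open>\<not> \<pi> dvd b'\<close>] by blast
    have "\<iota> r - emb \<iota> (u * a') = \<iota> r * emb \<iota> (1 - u * b')"
      by (simp add: emb_mult emb_diff flip: ra) (simp add: algebra_simps)
    then have "av (\<iota> r - emb \<iota> (u * a')) \<le> 1 * (1 / Q ^ n)"
      using r1 u by (simp only: av_mult) (intro mult_mono, auto simp: av_emb_le_iff)
    with n show ?thesis by (intro exI[of _ "u * a'"]) simp
  qed
  then obtain p where p: "av (\<iota> r - emb \<iota> p) < e" by blast
  have "av (t - emb \<iota> p) < e"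
    using p r av_ultra[of "t - \<iota> r" "\<iota> r - emb \<iota> p"] by (simp add: max_def split: if_splits)
  then show ?thesis by blast
qed

text \<open>The values at polynomials are determined by \<open>w 1\<close>, and polynomials are dense.\<close>

lemma Delta_kernel:
  assumes lin: "Fq_linear_on \<iota> O\<^sub>\<pi> w"
    and Delta: "\<And>t. t \<in> O\<^sub>\<pi> \<Longrightarrow> Delta_op \<iota> w t = 0"
    and cont: "\<And>e. e > 0 \<Longrightarrow> \<exists>d>0. \<forall>t\<in>O\<^sub>\<pi>. av t < d \<longrightarrow> av (w t) < e"
    and t: "t \<in> O\<^sub>\<pi>"
  shows "w t = t * w 1"
proof -
  have add: "w (y + z) = w y + w z" if "y \<in> O\<^sub>\<pi>" "z \<in> O\<^sub>\<pi>" for y z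
    using lin that by (simp add: Fq_linear_on_def)
  have hom: "w (k a * y) = k a * w y" if "y \<in> O\<^sub>\<pi>" for a y
    using lin that by (simp add: Fq_linear_on_def)
  have xi: "w (\<xi> * y) = \<xi> * w y" if "y \<in> O\<^sub>\<pi>" for y
    using Delta[OF that] by (simp add: Delta_op_def)
  have 0: "w 0 = 0" using hom[of 1 0] by simp
  have poly: "w (emb \<iota> p) = emb \<iota> p * w 1" for p
  proof (induction p)
    case (pCons a p)
    have "w (k a * 1 + \<xi> * emb \<iota> p) = k a * w 1 + \<xi> * w (emb \<iota> p)"
      by (subst add) (auto simp: hom xi simp del: mult_1_right)
    then show ?case
      unfolding pCons.IH by (subst (1 2) emb_pCons) (simp add: algebra_simps)
  qed (simp add: 0)
  have small: "av (w t - t * w 1) < e" if "e > 0" for e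
  proof -
    from cont[OF that] obtain d where d: "d > 0" "\<And>t. t \<in> O\<^sub>\<pi> \<Longrightarrow> av t < d \<Longrightarrow> av (w t) < e"
      by blast
    \<comment> \<open>Adding 1 keeps the divisor positive even if \<open>w 1\<close> is 0.\<close>
    have c: "av (w 1) + 1 > 0" using av_nonneg[of "w 1"] by linarith
    with d that have "min d (e / (av (w 1) + 1)) > 0" by simp
    from emb_dense[OF t this] obtain p where
      p: "av (t - emb \<iota> p) < d" "av (t - emb \<iota> p) < e / (av (w 1) + 1)" by auto
    let ?s = "t - emb \<iota> p"
    have s: "?s \<in> O\<^sub>\<pi>" using t by (rule O_set_diff_emb)
    have "w t = w (emb \<iota> p) + w ?s" using add[OF emb_in_O_set s, of p] by simp
    then have "w t - t * w 1 = w ?s - ?s * w 1" by (simp add: poly algebra_simps)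
    moreover have "av (?s * w 1) < e"
    proof -
      have "av (?s * w 1) \<le> av ?s * (av (w 1) + 1)"
        unfolding av_mult by (intro mult_left_mono) auto
      also have "\<dots> < e" using p(2) c by (simp add: pos_less_divide_eq)
      finally show ?thesis .
    qed
    ultimately show ?thesis
      using d(2)[OF s p(1)] av_diff[of "w ?s" "?s * w 1"] by (simp only: less_max_iff_disj max_def split: if_splits)
  qed
  have "av (w t - t * w 1) = 0"
    using small[of "av (w t - t * w 1)"] av_nonneg[of "w t - t * w 1"]
    by (metis less_irrefl order_le_less)
  then show ?thesis by simp
qed

subsection \<open>Carlitz polynomials on the ring of integers\<close>

text \<open>By density some polynomial lies within Q^(-i) of t; f_i is integral at the polynomial,
  and at the difference by \<open>av_f_poly_small\<close>.\<close>

lemma av_f_poly_le_1: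
  assumes "t \<in> O\<^sub>\<pi>"
  shows "av (f_poly \<iota> i t) \<le> 1"
proof -
  have "1 / Q ^ i > 0" using Q_pos by simp
  from emb_dense[OF assms this] obtain p where p: "av (t - emb \<iota> p) \<le> 1 / Q ^ i"
    by (auto intro: less_imp_le)
  then have "Q ^ i * av (t - emb \<iota> p) \<le> 1"
    using Q_pos by (simp add: pos_le_divide_eq mult.commute)
  with av_f_poly_small[OF p] have "av (f_poly \<iota> i (t - emb \<iota> p)) \<le> 1" by simp
  moreover have "f_poly \<iota> i t = f_poly \<iota> i (emb \<iota> p) + f_poly \<iota> i (t - emb \<iota> p)"
    by (simp flip: f_poly_add)
  ultimately show ?thesis by (simp add: av_add_le av_f_poly_emb)
qed

lemma av_f_poly_lipschitz:
  assumes "t \<in> O\<^sub>\<pi>"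
  shows "av (f_poly \<iota> i t) \<le> Q ^ i * av t"
proof (induction i)
  case (Suc i)
  have "av (f_poly \<iota> (Suc i) t) \<le> Q * av (f_poly \<iota> i t)"
    by (intro av_f_poly_Suc av_f_poly_le_1 assms)
  also have "\<dots> \<le> Q * (Q ^ i * av t)"
    using Suc Q_pos by (intro mult_left_mono) auto
  finally show ?case by (simp add: mult.assoc)
qed simp

section \<open>The products L_i and the derivatives of the f_i at 0\<close>

lemma L_seq_0 [simp]: "L_seq \<iota> 0 = 1"
  by (simp add: L_seq_def)

lemma L_seq_Suc: "L_seq \<iota> (Suc i) = br (Suc i) * L_seq \<iota> i"
  by (simp add: L_seq_def mult.commute)

lemma L_seq_nonzero: "L_seq \<iota> i \<noteq> 0"
  by (induction i) (simp_all add: L_seq_Suc bracket_nonzero)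

text \<open>The quotient consists of m inverse brackets, each of size at most
  \<open>Q\<close>.\<close>

lemma av_L_seq_quotient: "av (L_seq \<iota> i / L_seq \<iota> (i + m)) \<le> Q ^ m"
proof (induction m)
  case (Suc m)
  have "av (L_seq \<iota> i / L_seq \<iota> (i + Suc m)) = av (L_seq \<iota> i / L_seq \<iota> (i + m)) * (1 / av (br (Suc (i + m))))"
    by (simp add: L_seq_Suc av_divide av_mult)
  also have "\<dots> \<le> Q ^ m * Q"
    using Suc Q_pos by (intro mult_mono av_inverse_bracket_le) auto
  finally show ?case by (simp add: mult.commute)
qed (simp add: L_seq_nonzero)

lemma av_inverse_L_seq: "1 / av (L_seq \<iota> m) \<le> Q ^ m"
  using av_L_seq_quotient[of 0 m] by (simp add: av_divide)

lemma P_power_tendsto_0: "(\<lambda>n. av (P ^ n)) \<longlonglongrightarrow> 0"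
  using Q_gt_1 by (simp add: av_power av_P LIMSEQ_power_zero)

text \<open>In f_(i+1) = (f_i^q - f_i) / [i+1] the q-th power is of second order at 0 by the
  Lipschitz bound, so only - f_i / [i+1] contributes to the derivative, taken along the null
  sequence \<open>P ^ n\<close>.\<close>

lemma f_poly_derivative:
  "(\<lambda>n. f_poly \<iota> i (P ^ n) / P ^ n) \<longlonglongrightarrow> (- 1) ^ i / L_seq \<iota> i"
proof (induction i)
  case 0
  show ?case using P_nonzero by simp
next
  case (Suc i)
  have bound: "av (f_poly \<iota> i (P ^ n) ^ CARD('f) / P ^ n) \<le> (Q ^ i) ^ 2 * av (P ^ n)" for n
  proof -
    let ?a = "av (f_poly \<iota> i (P ^ n))" and ?p = "av (P ^ n)"
    have p: "?p > 0"
      using av_nonneg[of "P ^ n"] P_nonzero by (metis av_eq_0_iff order_le_less power_not_zero)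
    have "?a ^ CARD('f) \<le> ?a ^ 2"
      using q_ge_2 by (intro power_decreasing av_f_poly_le_1) auto
    also have "\<dots> \<le> (Q ^ i * ?p) ^ 2"
      by (intro power_mono av_f_poly_lipschitz) auto
    finally have "?a ^ CARD('f) / ?p \<le> (Q ^ i * ?p) ^ 2 / ?p" using p by (intro divide_right_mono) auto
    also have "\<dots> = (Q ^ i) ^ 2 * ?p" using p by (simp add: power2_eq_square)
    finally show ?thesis by (simp add: av_divide av_power)
  qed
  have "(\<lambda>n. (Q ^ i) ^ 2 * av (P ^ n)) \<longlonglongrightarrow> (Q ^ i) ^ 2 * 0"
    by (intro tendsto_mult tendsto_const P_power_tendsto_0)
  then have "(\<lambda>n. f_poly \<iota> i (P ^ n) ^ CARD('f) / P ^ n) \<longlonglongrightarrow> 0"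
    by (intro tendsto_0_av_le[OF bound]) simp
  from tendsto_cmult_av[OF tendsto_diff_av[OF this Suc], of "1 / br (Suc i)"]
  show ?case
    by (simp add: f_poly_Suc L_seq_Suc diff_divide_distrib mult.commute)
qed

subsection \<open>Carlitz expansions\<close>

text \<open>The weight Q^i bounds both the Lipschitz constant of f_i at 0 and the inverse of L_i, so
  the condition controls the expansion together with its linear term.\<close>

definition small :: "(nat \<Rightarrow> 'c) \<Rightarrow> bool" where
  "small c \<longleftrightarrow> (\<lambda>i. av (c i) * Q ^ i) \<longlonglongrightarrow> 0"

text \<open>The coefficient bound of the theorem with q^\<delta> abbreviated;
  \<open>decay_iff\<close> restores the form with \<open>powr\<close>.\<close>

definition decay :: "(nat \<Rightarrow> 'c) \<Rightarrow> bool" where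
  "decay c \<longleftrightarrow> (\<exists>C>0. \<forall>i>\<delta>. av (c i) \<le> C / Q ^ (CARD('f) ^ (i - \<delta>)))"

lemma decay_iff:
  "decay c \<longleftrightarrow> (\<exists>C>0. \<forall>i>\<delta>. av (c i) \<le> C * real CARD('f) powr (- real (\<delta> * CARD('f) ^ (i - \<delta>))))"
  unfolding decay_def by (simp only: of_nat_mult powr_Q times_divide_eq_right mult_1_right)

text \<open>With i = \<delta> + d, the inequality 2 d \<le> q^d bounds c_i by a multiple of Q^(-2
  d), which beats the weight Q^i and leaves a geometric sequence.\<close>

lemma decay_imp_small:
  assumes "decay c"
  shows "small c"
proof -
  obtain C where C: "C > 0" "\<And>i. i > \<delta> \<Longrightarrow> av (c i) \<le> C / Q ^ (CARD('f) ^ (i - \<delta>))"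
    using assms by (auto simp: decay_def)
  \<comment> \<open>The constant comes from Q^i / Q^(2 (i - \<delta>)) = Q^(2 \<delta>) /
    Q^i.\<close>
  have bound: "av (c i) * Q ^ i \<le> C * Q ^ (2 * \<delta>) * (1 / Q) ^ i" if "i > \<delta>" for i
  proof -
    define d where "d = i - \<delta>"
    with that have d: "i = \<delta> + d" by simp
    have "Q ^ (2 * d) \<le> Q ^ (CARD('f) ^ d)"
      using Q_gt_1 q_ge_2 by (intro power_increasing twice_le_power) auto
    then have "C / Q ^ (CARD('f) ^ d) \<le> C / Q ^ (2 * d)"
      using C(1) Q_pos by (intro divide_left_mono) auto
    with C(2)[OF that] have "av (c i) \<le> C / Q ^ (2 * d)" by (simp add: d)
    then have "av (c i) * Q ^ i \<le> C / Q ^ (2 * d) * Q ^ i"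
      using Q_pos by (intro mult_right_mono) auto
    also have "C / y ^ (2 * d) * y ^ i = C * y ^ (2 * \<delta>) * (1 / y) ^ i" if "y > 0" for y :: real
      using that by (simp add: d power_add mult_2 mult_2_right power_one_over field_simps)
    note this[OF Q_pos]
    finally show ?thesis .
  qed
  have "(\<lambda>i. C * Q ^ (2 * \<delta>) * (1 / Q) ^ i) \<longlonglongrightarrow> C * Q ^ (2 * \<delta>) * 0"
    using Q_gt_1 by (intro tendsto_mult tendsto_const LIMSEQ_power_zero) simp
  then have lim: "(\<lambda>i. C * Q ^ (2 * \<delta>) * (1 / Q) ^ i) \<longlonglongrightarrow> 0" by simp
  show ?thesis
    unfolding small_def
  proof (rule tendsto_sandwich[OF _ _ tendsto_const lim])
    show "\<forall>\<^sub>F i in sequentially. 0 \<le> av (c i) * Q ^ i" using Q_pos by simp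
    show "\<forall>\<^sub>F i in sequentially. av (c i) * Q ^ i \<le> C * Q ^ (2 * \<delta>) * (1 / Q) ^ i"
      using bound by (intro eventually_sequentiallyI[of "Suc \<delta>"]) auto
  qed
qed

lemma small_bounded: "small c \<Longrightarrow> \<exists>M>0. \<forall>i. av (c i) * Q ^ i \<le> M"
  unfolding small_def
proof -
  assume "(\<lambda>i. av (c i) * Q ^ i) \<longlonglongrightarrow> 0"
  then have "Bseq (\<lambda>i. av (c i) * Q ^ i)" using convergentI convergent_imp_Bseq by blast
  then show ?thesis
    by (elim BseqE) (metis abs_le_D1 real_norm_def)
qed

lemma small_eventually:
  assumes "small c" "e > 0"
  shows "\<exists>N. \<forall>i\<ge>N. av (c i) * Q ^ i \<le> e"
  using order_tendstoD(2)[OF assms(1)[unfolded small_def] assms(2)]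
  by (auto simp: eventually_sequentially intro: less_imp_le)

lemma small_av_tendsto_0: "small c \<Longrightarrow> c \<longlonglongrightarrow> 0"
proof (rule tendsto_0_av_le)
  show "av (c i) \<le> av (c i) * Q ^ i" for i
    using mult_left_mono[OF one_le_power[of Q i], of "av (c i)"] Q_gt_1 by simp
qed (simp add: small_def)

lemma av_term_le:
  assumes "t \<in> O\<^sub>\<pi>"
  shows "av (a * f_poly \<iota> i t) \<le> av a * Q ^ i * av t"
  using av_f_poly_lipschitz[OF assms, of i]
  by (simp add: av_mult mult.assoc mult_left_mono)

text \<open>The restriction makes the function extensional, as \<open>cont_linear\<close>
  demands.\<close>

definition expansion :: "(nat \<Rightarrow> 'c) \<Rightarrow> 'c \<Rightarrow> 'c" where
  "expansion c = restrict (\<lambda>t. \<Sum>i. c i * f_poly \<iota> i t) O\<^sub>\<pi>"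

lemma expansion_sums:
  assumes "small c" "t \<in> O\<^sub>\<pi>"
  shows "(\<lambda>i. c i * f_poly \<iota> i t) sums expansion c t"
proof -
  have "(\<lambda>i. c i * f_poly \<iota> i t) \<longlonglongrightarrow> 0"
  proof (rule tendsto_0_av_le[OF av_term_le[OF assms(2)]])
    show "(\<lambda>i. av (c i) * Q ^ i * av t) \<longlonglongrightarrow> 0"
      using assms(1) unfolding small_def by (rule tendsto_mult_left_zero)
  qed
  then have "\<exists>a. (\<lambda>i. c i * f_poly \<iota> i t) sums a"
    by (intro ultrametric_summable) (simp only: tendsto_0_av_iff)
  then have "summable (\<lambda>i. c i * f_poly \<iota> i t)" by (simp add: summable_def)
  then show ?thesis using assms(2) by (simp add: expansion_def summable_sums)
qed

text \<open>The factor \<open>av t\<close> lets one bound serve for the Lipschitz estimate at 0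
  (with N = 0), for uniform convergence and for the derivative at 0.\<close>

lemma expansion_tail:
  assumes "small c" "t \<in> O\<^sub>\<pi>" "\<And>i. i \<ge> N \<Longrightarrow> av (c i) * Q ^ i \<le> B"
  shows "av (expansion c t - (\<Sum>i<N. c i * f_poly \<iota> i t)) \<le> B * av t"
proof (rule ultrametric_tail_le[OF expansion_sums[OF assms(1,2)]])
  fix i assume "i \<ge> N"
  then have "av (c i) * Q ^ i * av t \<le> B * av t"
    using assms(3) by (intro mult_right_mono) auto
  then show "av (c i * f_poly \<iota> i t) \<le> B * av t"
    using av_term_le[OF assms(2)] order_trans by blast
qed

lemma expansion_lipschitz:
  assumes "small c"
  shows "\<exists>M>0. \<forall>t\<in>O\<^sub>\<pi>. av (expansion c t) \<le> M * av t"
proof -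
  obtain M where "M > 0" "\<And>i. av (c i) * Q ^ i \<le> M" using small_bounded[OF assms] by blast
  then show ?thesis using expansion_tail[OF assms, of _ 0 M] by auto
qed

lemma expansion_linear:
  assumes "small c"
  shows "Fq_linear_on \<iota> O\<^sub>\<pi> (expansion c)"
  unfolding Fq_linear_on_def
proof (intro conjI ballI allI)
  fix s t assume st: "s \<in> O\<^sub>\<pi>" "t \<in> O\<^sub>\<pi>"
  have "(\<lambda>i. c i * f_poly \<iota> i (s + t)) sums (expansion c s + expansion c t)"
    using sums_add_av[OF expansion_sums[OF assms st(1)] expansion_sums[OF assms st(2)]]
    by (simp add: f_poly_add distrib_left)
  then show "expansion c (s + t) = expansion c s + expansion c t"
    using expansion_sums[OF assms O_set_add[OF st]] sums_unique2 by blast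
next
  fix a t assume t: "t \<in> O\<^sub>\<pi>"
  have "(\<lambda>i. c i * f_poly \<iota> i (k a * t)) sums (k a * expansion c t)"
    using sums_cmult_av[OF expansion_sums[OF assms t], of "k a"]
    by (simp add: f_poly_k mult.left_commute)
  then show "expansion c (k a * t) = k a * expansion c t"
    using expansion_sums[OF assms O_set_emb_mult[OF t]] sums_unique2 by blast
qed

lemma O_set_diff: "s \<in> O\<^sub>\<pi> \<Longrightarrow> t \<in> O\<^sub>\<pi> \<Longrightarrow> s - t \<in> O\<^sub>\<pi>"
  using O_set_add[of s "emb \<iota> (- 1) * t"] O_set_emb_mult[of t "- 1"] by (simp add: emb_minus)

lemma Fq_linear_on_diff:
  assumes "Fq_linear_on \<iota> O\<^sub>\<pi> u" "s \<in> O\<^sub>\<pi>" "t \<in> O\<^sub>\<pi>"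
  shows "u (s - t) = u s - u t"
proof -
  have "u ((s - t) + t) = u (s - t) + u t"
    using assms O_set_diff unfolding Fq_linear_on_def by blast
  then show ?thesis by simp
qed

lemma expansion_cont_linear:
  assumes "small c"
  shows "cont_linear \<iota> (expansion c)"
  unfolding cont_linear_def
proof (intro conjI expansion_linear[OF assms])
  show "expansion c \<in> O\<^sub>\<pi> \<rightarrow>\<^sub>E UNIV" by (simp add: expansion_def)
  obtain M where M: "M > 0" "\<And>t. t \<in> O\<^sub>\<pi> \<Longrightarrow> av (expansion c t) \<le> M * av t"
    using expansion_lipschitz[OF assms] by blast
  show "continuous_on O\<^sub>\<pi> (expansion c)"
    unfolding continuous_on_iff
  proof (intro ballI allI impI)
    fix t and e :: real assume t: "t \<in> O\<^sub>\<pi>" and e: "e > 0"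
    have "dist (expansion c s) (expansion c t) < e" if s: "s \<in> O\<^sub>\<pi>" and d: "dist s t < e / M" for s
    proof -
      have "dist (expansion c s) (expansion c t) \<le> M * av (s - t)"
        using M(2)[OF O_set_diff[OF s t]] Fq_linear_on_diff[OF expansion_linear[OF assms] s t]
        by (simp add: dist_av)
      also have "\<dots> < e" using d M(1) by (simp add: dist_av pos_less_divide_eq mult.commute)
      finally show ?thesis .
    qed
    then show "\<exists>d>0. \<forall>s\<in>O\<^sub>\<pi>. dist s t < d \<longrightarrow> dist (expansion c s) (expansion c t) < e"
      using e M(1) by (intro exI[of _ "e / M"]) auto
  qed
qed

lemma carlitz_expansion_expansion:
  assumes "small c"
  shows "carlitz_expansion \<iota> c (expansion c)"
  unfolding carlitz_expansion_def uniform_limit_iff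
proof (intro allI impI)
  fix e :: real assume "e > 0"
  then obtain N where N: "\<And>i. i \<ge> N \<Longrightarrow> av (c i) * Q ^ i \<le> e / 2"
    using small_eventually[OF assms, of "e / 2"] by auto
  have "dist (\<Sum>i<n. c i * f_poly \<iota> i t) (expansion c t) < e" if "n \<ge> N" "t \<in> O\<^sub>\<pi>" for n t
  proof -
    have "av (expansion c t - (\<Sum>i<n. c i * f_poly \<iota> i t)) \<le> e / 2 * av t"
      using that N by (intro expansion_tail[OF assms]) auto
    also have "\<dots> \<le> e / 2 * 1"
      using that(2) \<open>e > 0\<close> by (intro mult_left_mono) (auto simp: O_set_def)
    finally show ?thesis using \<open>e > 0\<close> by (simp add: dist_av av_diff_commute)
  qed
  then show "\<forall>\<^sub>F n in sequentially. \<forall>t\<in>O\<^sub>\<pi>. dist (\<Sum>i<n. c i * f_poly \<iota> i t) (expansion c t) < e"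
    by (intro eventually_sequentiallyI[of N]) auto
qed

lemma carlitz_expansion_sums:
  assumes "carlitz_expansion \<iota> c u" "t \<in> O\<^sub>\<pi>"
  shows "(\<lambda>i. c i * f_poly \<iota> i t) sums u t"
  using tendsto_uniform_limitI[OF assms(1)[unfolded carlitz_expansion_def] assms(2)]
  by (simp add: sums_def)

text \<open>\<Delta> is applied term by term, and the summands [i] f_i + f_(i-1) are regrouped by
  f_i; the boundary term of this summation by parts tends to 0.\<close>

lemma Delta_expansion_sums:
  assumes "small c" "t \<in> O\<^sub>\<pi>"
  shows "(\<lambda>i. (c (Suc i) + br i * c i) * f_poly \<iota> i t) sums Delta_op \<iota> (expansion c) t"
proof -
  let ?D = "\<lambda>i. c i * Delta_op \<iota> (f_poly \<iota> i) t"
  have "(\<lambda>i. c i * f_poly \<iota> i (\<xi> * t) - \<xi> * (c i * f_poly \<iota> i t))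
      sums (expansion c (\<xi> * t) - \<xi> * expansion c t)"
    by (intro sums_diff_av sums_cmult_av expansion_sums assms O_set_xi_mult)
  then have "?D sums Delta_op \<iota> (expansion c) t"
    by (simp add: Delta_op_def algebra_simps)
  then have 1: "(\<lambda>N. \<Sum>i<Suc N. ?D i) \<longlonglongrightarrow> Delta_op \<iota> (expansion c) t"
    unfolding sums_def by (rule LIMSEQ_Suc)
  \<comment> \<open>This is the unpaired half of the summand with index N: its partner stems from
    index N + 1.\<close>
  have "(\<lambda>N. br N * c N * f_poly \<iota> N t) \<longlonglongrightarrow> 0"
  proof (rule tendsto_0_av_le)
    show "av (br N * c N * f_poly \<iota> N t) \<le> av (c N)" for N
      using av_f_poly_le_1[OF assms(2), of N]
      by (simp add: av_mult mult_left_le_one_le mult_right_le_one_le mult_le_one mult.assoc mult.left_commute)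
    show "(\<lambda>N. av (c N)) \<longlonglongrightarrow> 0"
      using small_av_tendsto_0[OF assms(1)] by (simp only: tendsto_0_av_iff)
  qed
  from tendsto_diff_av[OF 1 this]
  have "(\<lambda>N. (\<Sum>i<Suc N. ?D i) - br N * c N * f_poly \<iota> N t) \<longlonglongrightarrow> Delta_op \<iota> (expansion c) t"
    by simp
  moreover have "(\<Sum>i<Suc N. ?D i) - br N * c N * f_poly \<iota> N t
      = (\<Sum>i<N. (c (Suc i) + br i * c i) * f_poly \<iota> i t)" for N
  proof (induction N)
    case 0
    show ?case by (simp add: Delta_f_poly_0 del: f_poly_0)
  next
    case (Suc N)
    have "(\<Sum>i<Suc (Suc N). ?D i) - br (Suc N) * c (Suc N) * f_poly \<iota> (Suc N) t
        = (\<Sum>i<Suc N. ?D i) + c (Suc N) * f_poly \<iota> N t"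
      by (simp add: Delta_f_poly_Suc algebra_simps)
    also have "\<dots> = (\<Sum>i<N. (c (Suc i) + br i * c i) * f_poly \<iota> i t) + br N * c N * f_poly \<iota> N t
        + c (Suc N) * f_poly \<iota> N t"
      using Suc by (simp only: diff_eq_eq)
    finally show ?case by (simp add: algebra_simps)
  qed
  ultimately show ?thesis by (simp add: sums_def)
qed

text \<open>The relation for \<open>c\<^sub>0\<close> says that the linear term of the expansion vanishes.\<close>

lemma c0_relation_sums:
  assumes "c0_relation \<iota> c"
  shows "(\<lambda>i. c i * ((- 1) ^ i / L_seq \<iota> i)) sums 0"
proof -
  let ?g = "\<lambda>i. c i * ((- 1) ^ i / L_seq \<iota> i)"
  have "(\<lambda>n. \<Sum>i<n. (- 1) ^ (Suc i + 1) * c (Suc i) / L_seq \<iota> (Suc i)) \<longlonglongrightarrow> c 0"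
    using assms by (simp add: c0_relation_def sums_def)
  from tendsto_diff_av[OF tendsto_const[of "c 0"] this]
  have "(\<lambda>n. c 0 - (\<Sum>i<n. (- 1) ^ (Suc i + 1) * c (Suc i) / L_seq \<iota> (Suc i))) \<longlonglongrightarrow> 0"
    by simp
  moreover have "c 0 - (\<Sum>i<n. (- 1) ^ (Suc i + 1) * c (Suc i) / L_seq \<iota> (Suc i)) = sum ?g {..<Suc n}" for n
    by (induction n) (simp_all add: algebra_simps)
  ultimately have "(\<lambda>n. sum ?g {..<Suc n}) \<longlonglongrightarrow> 0" by simp
  then show ?thesis unfolding sums_def by (rule LIMSEQ_imp_Suc)
qed

text \<open>The derivative of the first N terms is a partial sum of a series with sum 0, hence small
  for large N; the remainder divided by its argument is small uniformly, by
  \<open>expansion_tail\<close>.\<close>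

lemma expansion_derivative_0:
  assumes "small c" "c0_relation \<iota> c"
  shows "(\<lambda>n. expansion c (P ^ n) / P ^ n) \<longlonglongrightarrow> 0"
  unfolding tendsto_0_av_iff
proof (rule order_tendstoI)
  fix e :: real assume "e > 0"
  then obtain N where N: "\<And>i. i \<ge> N \<Longrightarrow> av (c i) * Q ^ i \<le> e / 2"
    using small_eventually[OF assms(1), of "e / 2"] by auto
  let ?A = "\<Sum>i<N. c i * ((- 1) ^ i / L_seq \<iota> i)"
  let ?B = "\<lambda>n. \<Sum>i<N. c i * (f_poly \<iota> i (P ^ n) / P ^ n)"
  have "av (0 - ?A) \<le> e / 2"
  proof (rule ultrametric_tail_le[OF c0_relation_sums[OF assms(2)]])
    fix i assume "i \<ge> N"
    have "av (c i * ((- 1) ^ i / L_seq \<iota> i)) = av (c i) * (1 / av (L_seq \<iota> i))"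
      by (simp add: av_mult av_divide)
    also have "\<dots> \<le> av (c i) * Q ^ i" by (intro mult_left_mono av_inverse_L_seq) simp
    finally show "av (c i * ((- 1) ^ i / L_seq \<iota> i)) \<le> e / 2" using N[OF \<open>i \<ge> N\<close>] by linarith
  qed
  then have A: "av ?A < e" using \<open>e > 0\<close> by simp
  have "?B \<longlonglongrightarrow> ?A" by (intro tendsto_sum_av tendsto_cmult_av f_poly_derivative)
  then have "(\<lambda>n. av (?B n - ?A)) \<longlonglongrightarrow> 0" by (simp only: tendsto_av_iff)
  then have "\<forall>\<^sub>F n in sequentially. av (?B n - ?A) < e" using \<open>e > 0\<close> by (rule order_tendstoD)
  then show "\<forall>\<^sub>F n in sequentially. av (expansion c (P ^ n) / P ^ n) < e"
  proof eventually_elim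
    case (elim n)
    have p: "av (P ^ n) > 0"
      using av_nonneg[of "P ^ n"] P_nonzero by (metis av_eq_0_iff order_le_less power_not_zero)
    have "av (expansion c (P ^ n) - (\<Sum>i<N. c i * f_poly \<iota> i (P ^ n))) \<le> e / 2 * av (P ^ n)"
      using N by (intro expansion_tail[OF assms(1)]) auto
    then have "av ((expansion c (P ^ n) - (\<Sum>i<N. c i * f_poly \<iota> i (P ^ n))) / P ^ n) \<le> e / 2"
      unfolding av_divide using p by (simp add: pos_divide_le_eq)
    then have "av (expansion c (P ^ n) / P ^ n - ?B n) < e"
      using \<open>e > 0\<close> by (simp add: diff_divide_distrib sum_divide_distrib)
    moreover have "av (?B n) < e"
      using av_ultra[of "?B n - ?A" ?A] elim A by simp
    ultimately show ?case
      using av_ultra[of "expansion c (P ^ n) / P ^ n - ?B n" "?B n"] by simp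
  qed
next
  fix e :: real assume "e < 0"
  then show "\<forall>\<^sub>F n in sequentially. e < av (expansion c (P ^ n) / P ^ n)"
    by (intro always_eventually allI order.strict_trans2[OF _ av_nonneg])
qed

subsection \<open>The polylogarithm series\<close>

definition polylog_term :: "nat \<Rightarrow> 'c \<Rightarrow> nat \<Rightarrow> 'c" where
  "polylog_term n t j = t ^ (CARD('f) ^ Suc j) / br (Suc j) ^ n"

definition polylog :: "nat \<Rightarrow> 'c \<Rightarrow> 'c" where
  "polylog n t = (\<Sum>j. polylog_term n t j)"

lemma coincides_iff:
  "coincides_with_polylog_series \<pi> \<iota> n u \<longleftrightarrow>
     (\<forall>t\<in>K\<^sub>\<pi>. av t \<le> 1 / Q \<longrightarrow> polylog_term n t sums u t)"
  using powr_Q[of 1] by (simp add: coincides_with_polylog_series_def polylog_term_def[abs_def])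

lemma av_polylog_term:
  assumes "av t \<le> 1" "m \<le> CARD('f) ^ Suc j"
  shows "av (polylog_term n t j) \<le> Q ^ n * av t ^ m"
proof -
  have "av (polylog_term n t j) = (1 / av (br (Suc j))) ^ n * av t ^ (CARD('f) ^ Suc j)"
    by (simp add: polylog_term_def av_divide av_power power_one_over)
  also have "\<dots> \<le> Q ^ n * av t ^ m"
    using assms Q_pos
    by (intro mult_mono power_mono av_inverse_bracket_le power_decreasing) auto
  finally show ?thesis .
qed

lemma polylog_sums:
  assumes "av t \<le> 1 / Q"
  shows "polylog_term n t sums polylog n t"
proof -
  have "1 / Q \<le> 1" using Q_gt_1 by simp
  with assms have t1: "av t \<le> 1" by linarith
  have "polylog_term n t \<longlonglongrightarrow> 0"
  proof (rule tendsto_0_av_le)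
    show "av (polylog_term n t j) \<le> Q ^ n * (1 / Q) ^ j" for j
    proof -
      have "j \<le> CARD('f) ^ Suc j"
        using twice_le_power[OF q_ge_2, of "Suc j"] by simp
      then have "av (polylog_term n t j) \<le> Q ^ n * av t ^ j" by (rule av_polylog_term[OF t1])
      also have "\<dots> \<le> Q ^ n * (1 / Q) ^ j"
        using assms Q_pos by (intro mult_left_mono power_mono) auto
      finally show ?thesis .
    qed
    have "(\<lambda>j. Q ^ n * (1 / Q) ^ j) \<longlonglongrightarrow> Q ^ n * 0"
      using Q_gt_1 by (intro tendsto_mult tendsto_const LIMSEQ_power_zero) simp
    then show "(\<lambda>j. Q ^ n * (1 / Q) ^ j) \<longlonglongrightarrow> 0" by simp
  qed
  then have "\<exists>a. polylog_term n t sums a"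
    by (intro ultrametric_summable) (simp only: tendsto_0_av_iff)
  then show ?thesis
    unfolding polylog_def by (intro summable_sums) (simp add: summable_def)
qed

text \<open>Every exponent q^(j+1) is at least 2, so the series has no linear term; this gives
  derivative 0 at 0.\<close>

lemma av_polylog_le:
  assumes "av t \<le> 1 / Q"
  shows "av (polylog n t) \<le> Q ^ n * av t ^ 2"
proof (rule av_sums_le[OF polylog_sums[OF assms]])
  fix j
  have "1 / Q \<le> 1" using Q_gt_1 by simp
  with assms have t1: "av t \<le> 1" by linarith
  have "2 * Suc j \<le> CARD('f) ^ Suc j" by (rule twice_le_power[OF q_ge_2])
  then have "2 \<le> CARD('f) ^ Suc j" by simp
  then show "av (polylog_term n t j) \<le> Q ^ n * av t ^ 2" by (rule av_polylog_term[OF t1])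
qed

lemma polylog_term_add: "polylog_term n (s + t) j = polylog_term n s j + polylog_term n t j"
  by (simp only: polylog_term_def power_qn_add add_divide_distrib)

lemma polylog_term_k: "polylog_term n (k a * t) j = k a * polylog_term n t j"
  by (simp only: polylog_term_def power_mult_distrib k_power_qn times_divide_eq_right)

text \<open>The left side acquires the factor x^(q^(j+1)) - x = [j+1], which cancels one bracket of
  the denominator.\<close>

lemma polylog_term_shift:
  "polylog_term (Suc n) (\<xi> * t) j - \<xi> * polylog_term (Suc n) t j = polylog_term n t j"
proof -
  let ?b = "br (Suc j)" and ?T = "t ^ (CARD('f) ^ Suc j)"
  have "polylog_term (Suc n) (\<xi> * t) j - \<xi> * polylog_term (Suc n) t j = ?b * ?T / ?b ^ Suc n"
    unfolding polylog_term_def bracket_def[of \<iota> "Suc j"] power_mult_distrib[of \<xi>]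
    by (simp only: left_diff_distrib diff_divide_distrib times_divide_eq_right)
  also have "\<dots> = polylog_term n t j"
    using bracket_nonzero[of "Suc j"] by (simp add: polylog_term_def)
  finally show ?thesis .
qed

lemma coincides_polylog:
  assumes "coincides_with_polylog_series \<pi> \<iota> n u" "t \<in> K\<^sub>\<pi>" "av t \<le> 1 / Q"
  shows "u t = polylog n t"
  using assms polylog_sums[OF assms(3)] sums_unique2 unfolding coincides_iff by blast

lemma polylog_add: "av s \<le> 1 / Q \<Longrightarrow> av t \<le> 1 / Q \<Longrightarrow> polylog n (s + t) = polylog n s + polylog n t"
  using sums_add_av[OF polylog_sums polylog_sums, of s t n n] polylog_sums[of "s + t" n] sums_unique2
  by (auto simp: av_add_le polylog_term_add[abs_def])

lemma av_mult_le: "av s \<le> 1 \<Longrightarrow> av t \<le> B \<Longrightarrow> av (s * t :: 'c) \<le> B"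
proof -
  assume "av s \<le> 1" "av t \<le> B"
  then have "av s * av t \<le> 1 * av t" by (intro mult_right_mono) simp_all
  with \<open>av t \<le> B\<close> show ?thesis by (simp add: av_mult)
qed

lemma polylog_k:
  assumes "av t \<le> 1 / Q"
  shows "polylog n (k a * t) = k a * polylog n t"
proof -
  have "polylog_term n (k a * t) sums polylog n (k a * t)"
    using assms by (intro polylog_sums av_mult_le) simp
  moreover have "polylog_term n (k a * t) sums (k a * polylog n t)"
    unfolding polylog_term_k[abs_def] by (intro sums_cmult_av polylog_sums assms)
  ultimately show ?thesis by (rule sums_unique2)
qed

lemma polylog_shift:
  assumes "av t \<le> 1 / Q"
  shows "polylog (Suc n) (\<xi> * t) - \<xi> * polylog (Suc n) t = polylog n t"
proof -
  have "(\<lambda>j. polylog_term (Suc n) (\<xi> * t) j - \<xi> * polylog_term (Suc n) t j)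
      sums (polylog (Suc n) (\<xi> * t) - \<xi> * polylog (Suc n) t)"
    using assms by (intro sums_diff_av sums_cmult_av polylog_sums av_mult_le) simp_all
  then show ?thesis
    using polylog_sums[OF assms, of n] unfolding polylog_term_shift by (rule sums_unique2)
qed

lemma P_mult:
  assumes "s \<in> O\<^sub>\<pi>"
  shows "P * s \<in> O\<^sub>\<pi>" "P * s \<in> K\<^sub>\<pi>" "av (P * s) \<le> 1 / Q"
proof -
  show "P * s \<in> O\<^sub>\<pi>" using assms by (rule O_set_emb_mult)
  then show "P * s \<in> K\<^sub>\<pi>" by (simp add: O_set_def)
  show "av (P * s) \<le> 1 / Q"
    using assms Q_pos by (simp add: av_mult av_P O_set_def divide_right_mono)
qed

text \<open>On the small ball, the difference of the expansion and the series lies in the kernel of \<open>\<Delta>\<close>,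
  so it is a multiple of \<open>t\<close>; the multiple is zero, since both functions have derivative \<open>0\<close> at \<open>0\<close>.\<close>

lemma expansion_coincides:
  assumes small: "small c" and rel: "c0_relation \<iota> c"
    and v: "coincides_with_polylog_series \<pi> \<iota> n v"
    and Delta: "\<And>t. t \<in> O\<^sub>\<pi> \<Longrightarrow> Delta_op \<iota> (expansion c) t = v t"
  shows "coincides_with_polylog_series \<pi> \<iota> (Suc n) (expansion c)"
proof -
  \<comment> \<open>Multiplication by \<open>P\<close> carries \<open>O\<^sub>\<pi>\<close> onto the
    small ball and commutes with \<Delta>, so \<open>Delta_kernel\<close>, stated on
    \<open>O\<^sub>\<pi>\<close>, becomes applicable.\<close>
  define w where "w s = expansion c (P * s) - polylog (Suc n) (P * s)" for s
  note lin = expansion_linear[OF small, unfolded Fq_linear_on_def]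
  have linear: "Fq_linear_on \<iota> O\<^sub>\<pi> w"
    unfolding Fq_linear_on_def
  proof (intro conjI ballI allI)
    fix s t assume "s \<in> O\<^sub>\<pi>" "t \<in> O\<^sub>\<pi>"
    then show "w (s + t) = w s + w t"
      using lin P_mult[of s] P_mult[of t] by (simp add: w_def distrib_left polylog_add)
  next
    fix a t assume t: "t \<in> O\<^sub>\<pi>"
    have "expansion c (k a * (P * t)) = k a * expansion c (P * t)" using lin P_mult(1)[OF t] by blast
    then show "w (k a * t) = k a * w t"
      using polylog_k[OF P_mult(3)[OF t], of "Suc n" a]
      by (simp only: w_def mult.left_commute[of P "k a"] right_diff_distrib)
  qed
  have kernel: "Delta_op \<iota> w s = 0" if s: "s \<in> O\<^sub>\<pi>" for s
  proof -
    have "Delta_op \<iota> (expansion c) (P * s) = polylog n (P * s)"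
      using Delta[OF P_mult(1)[OF s]] coincides_polylog[OF v P_mult(2,3)[OF s]] by simp
    then show ?thesis
      using polylog_shift[OF P_mult(3)[OF s], of n]
      by (simp add: Delta_op_def w_def mult.left_commute[of P \<xi>] algebra_simps)
  qed
  obtain M where M: "M > 0" "\<And>t. t \<in> O\<^sub>\<pi> \<Longrightarrow> av (expansion c t) \<le> M * av t"
    using expansion_lipschitz[OF small] by blast
  have lipschitz: "av (w s) \<le> (M + Q ^ Suc n) * av s" if s: "s \<in> O\<^sub>\<pi>" for s
  proof -
    let ?t = "P * s"
    have ts: "av ?t \<le> av s"
      by (intro av_mult_le) simp_all
    have s1: "av s \<le> 1" using s by (simp add: O_set_def)
    have "av ?t ^ 2 \<le> av s ^ 2" using ts by (intro power_mono) auto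
    also have "\<dots> \<le> av s ^ 1" using s1 by (intro power_decreasing) auto
    finally have "Q ^ Suc n * av ?t ^ 2 \<le> Q ^ Suc n * av s"
      using Q_pos by (intro mult_left_mono) auto
    with av_polylog_le[OF P_mult(3)[OF s], of "Suc n"]
    have 1: "av (polylog (Suc n) ?t) \<le> Q ^ Suc n * av s" by linarith
    have "M * av ?t \<le> M * av s" using M(1) ts by (intro mult_left_mono) auto
    with M(2)[OF P_mult(1)[OF s]] have 2: "av (expansion c ?t) \<le> M * av s" by linarith
    have "0 \<le> M * av s" "0 \<le> Q ^ Suc n * av s" using M(1) Q_pos by simp_all
    with 1 2 have "av (w s) \<le> M * av s + Q ^ Suc n * av s"
      unfolding w_def by (intro av_diff_le) linarith+
    then show ?thesis by (simp only: distrib_right)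
  qed
  have cont: "\<exists>d>0. \<forall>s\<in>O\<^sub>\<pi>. av s < d \<longrightarrow> av (w s) < e" if e: "e > 0" for e
  proof -
    have c: "M + Q ^ Suc n > 0" using M(1) Q_pos by (simp add: add_pos_pos)
    have "av (w s) < e" if "s \<in> O\<^sub>\<pi>" "av s < e / (M + Q ^ Suc n)" for s
      using lipschitz[OF that(1)] that(2) unfolding pos_less_divide_eq[OF c] by (simp only: mult.commute)
    then show ?thesis using c e by (intro exI[of _ "e / (M + Q ^ Suc n)"]) (simp del: power_Suc)
  qed
  have w: "w s = s * w 1" if "s \<in> O\<^sub>\<pi>" for s
    using Delta_kernel[OF linear kernel cont that] .
  \<comment> \<open>Being equal to every difference quotient at \<open>P ^ m\<close>,
    \<open>w 1\<close> equals their limit, the derivative of w at 0.\<close>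
  have "w 1 = w (P ^ m) / P ^ m" for m
    using w[OF P_power_in_O_set[of m]] P_nonzero by simp
  then have eq: "w 1 = P * (expansion c (P ^ Suc m) / P ^ Suc m) - polylog (Suc n) (P ^ Suc m) / P ^ m" for m
    using P_nonzero by (simp add: w_def diff_divide_distrib)
  have "(\<lambda>m. polylog (Suc n) (P ^ Suc m) / P ^ m) \<longlonglongrightarrow> 0"
  proof (rule tendsto_0_av_le)
    show "av (polylog (Suc n) (P ^ Suc m) / P ^ m) \<le> Q ^ Suc n * av (P ^ m)" for m
    proof -
      let ?p = "av (P ^ m)"
      have p: "?p > 0"
        using av_nonneg[of "P ^ m"] P_nonzero by (metis av_eq_0_iff order_le_less power_not_zero)
      have le: "av (P ^ Suc m) \<le> ?p" "av (P ^ Suc m) \<le> 1 / Q"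
        using P_mult(3)[OF P_power_in_O_set[of m]] by (simp_all add: av_mult_le)
      have "av (polylog (Suc n) (P ^ Suc m)) \<le> Q ^ Suc n * av (P ^ Suc m) ^ 2"
        by (rule av_polylog_le[OF le(2)])
      also have "\<dots> \<le> Q ^ Suc n * ?p ^ 2"
        using le(1) Q_pos by (intro mult_left_mono power_mono) auto
      finally have "av (polylog (Suc n) (P ^ Suc m)) \<le> Q ^ Suc n * ?p * ?p"
        by (simp only: power2_eq_square mult.assoc)
      then show ?thesis unfolding av_divide by (simp only: pos_divide_le_eq[OF p])
    qed
    show "(\<lambda>m. Q ^ Suc n * av (P ^ m)) \<longlonglongrightarrow> 0"
      by (intro tendsto_mult_right_zero P_power_tendsto_0)
  qed
  with tendsto_cmult_av[OF LIMSEQ_Suc[OF expansion_derivative_0[OF small rel]], of P]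
  have "(\<lambda>m. P * (expansion c (P ^ Suc m) / P ^ Suc m) - polylog (Suc n) (P ^ Suc m) / P ^ m) \<longlonglongrightarrow> P * 0 - 0"
    by (rule tendsto_diff_av)
  then have "(\<lambda>m::nat. w 1) \<longlonglongrightarrow> 0" unfolding eq[symmetric] by simp
  then have w1: "w 1 = 0" by (simp add: LIMSEQ_const_iff)
  show ?thesis
    unfolding coincides_iff
  proof (intro ballI impI)
    fix t assume t: "t \<in> K\<^sub>\<pi>" "av t \<le> 1 / Q"
    from w[OF divide_P_in_O_set[OF t]] have "expansion c t = polylog (Suc n) t"
      using P_nonzero unfolding w1 by (simp add: w_def)
    then show "polylog_term (Suc n) t sums expansion c t"
      using polylog_sums[OF t(2)] by simp
  qed
qed

subsection \<open>The recursion for the coefficients\<close>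

lemma exists_next_coefficients:
  assumes "decay c" "c0_relation \<iota> c"
  shows "\<exists>c'. decay c' \<and> c0_relation \<iota> c' \<and> (\<forall>i. c' (Suc i) + br i * c' i = c i)"
proof -
  let ?g = "\<lambda>i. c i * ((- 1) ^ i / L_seq \<iota> i)"
  \<comment> \<open>\<open>h m\<close> is the new coefficient of index m + 1; the one of index 0 is
    set by the series that \<open>c0_relation\<close> demands, whose convergence is shown
    below.\<close>
  define h where "h m = (- 1) ^ m * L_seq \<iota> m * sum ?g {..<Suc m}" for m
  define c' where "c' = case_nat (\<Sum>i. (- 1) ^ (Suc i + 1) * h i / L_seq \<iota> (Suc i)) h"
  have c'_Suc: "c' (Suc m) = h m" for m by (simp add: c'_def)
  obtain C where C: "C > 0" "\<And>i. i > \<delta> \<Longrightarrow> av (c i) \<le> C / Q ^ (CARD('f) ^ (i - \<delta>))"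
    using assms(1) by (auto simp: decay_def)
  \<comment> \<open>The full sum being 0, the partial sum in \<open>h\<close> is minus the tail from
    m + 1 on. The exponent contains \<open>Suc m\<close> because that is the index of
    \<open>h m\<close> in c'.\<close>
  have bound: "av (h m) \<le> C * Q / Q ^ (CARD('f) ^ (Suc m - \<delta>))" if m: "m \<ge> \<delta>" for m
  proof -
    have "(\<lambda>i. L_seq \<iota> m * ?g i) sums (L_seq \<iota> m * 0)"
      by (intro sums_cmult_av c0_relation_sums assms(2))
    then have "(\<lambda>i. L_seq \<iota> m * ?g i) sums 0" by simp
    moreover have "av (L_seq \<iota> m * ?g i) \<le> C * Q / Q ^ (CARD('f) ^ (Suc m - \<delta>))" if i: "i \<ge> Suc m" for i
    proof -
      define d where "d = i - Suc m"
      have d: "i = m + Suc d" using i by (simp add: d_def)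
      have id: "i - \<delta> = (Suc m - \<delta>) + d" using d m by simp
      \<comment> \<open>The d + 1 brackets of L_i / L_m cost Q^(d+1). With e = m + 1 - \<delta>, the
        growth q^e + d \<le> q^(e+d) pays for d of them; the last one is the factor \<open>Q\<close>
        in the constant.\<close>
      have "Q ^ (CARD('f) ^ (Suc m - \<delta>) + d) \<le> Q ^ (CARD('f) ^ (i - \<delta>))"
        unfolding id using Q_gt_1 q_ge_2 by (intro power_increasing power_add_le_power) auto
      then have "C / Q ^ (CARD('f) ^ (i - \<delta>)) \<le> C / Q ^ (CARD('f) ^ (Suc m - \<delta>) + d)"
        using C(1) Q_pos by (intro divide_left_mono) auto
      moreover have "av (c i) \<le> C / Q ^ (CARD('f) ^ (i - \<delta>))" using C(2) m i by simp
      ultimately have ci: "av (c i) \<le> C / Q ^ (CARD('f) ^ (Suc m - \<delta>) + d)" by linarith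
      have "av (L_seq \<iota> m * ?g i) = av (c i) * av (L_seq \<iota> m / L_seq \<iota> i)"
        by (simp add: av_mult av_divide)
      also have "\<dots> \<le> C / Q ^ (CARD('f) ^ (Suc m - \<delta>) + d) * Q ^ Suc d"
        using ci C(1) Q_pos unfolding d by (intro mult_mono av_L_seq_quotient) auto
      also have "\<dots> = C * Q / Q ^ (CARD('f) ^ (Suc m - \<delta>))"
        using Q_pos by (simp only: power_add power_Suc2) simp
      finally show ?thesis .
    qed
    ultimately have "av (0 - (\<Sum>i<Suc m. L_seq \<iota> m * ?g i)) \<le> C * Q / Q ^ (CARD('f) ^ (Suc m - \<delta>))"
      by (rule ultrametric_tail_le)
    moreover have "av (h m) = av (0 - (\<Sum>i<Suc m. L_seq \<iota> m * ?g i))"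
      by (simp only: h_def sum_distrib_left[symmetric] diff_0 av_minus av_mult av_neg_one_power mult_1_left)
    ultimately show ?thesis by simp
  qed
  have decay: "decay c'"
    unfolding decay_def
  proof (intro exI[of _ "C * Q"] conjI allI impI)
    show "C * Q > 0" using C(1) Q_pos by simp
    fix i assume i: "i > \<delta>"
    then obtain m where m: "i = Suc m" using less_imp_Suc_add by blast
    show "av (c' i) \<le> C * Q / Q ^ (CARD('f) ^ (i - \<delta>))"
      unfolding m c'_Suc using i m by (intro bound) simp
  qed
  have "(\<lambda>i. (- 1) ^ (Suc i + 1) * h i / L_seq \<iota> (Suc i)) \<longlonglongrightarrow> 0"
  proof (rule tendsto_0_av_le)
    show "av ((- 1) ^ (Suc i + 1) * h i / L_seq \<iota> (Suc i)) \<le> av (c' (Suc i)) * Q ^ Suc i" for i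
    proof -
      have "av ((- 1) ^ (Suc i + 1) * h i / L_seq \<iota> (Suc i)) = av (h i) * (1 / av (L_seq \<iota> (Suc i)))"
        by (simp only: av_divide av_mult av_neg_one_power mult_1_left times_divide_eq_right mult_1_right)
      also have "\<dots> \<le> av (h i) * Q ^ Suc i" by (intro mult_left_mono av_inverse_L_seq) simp
      finally show ?thesis by (simp only: c'_Suc)
    qed
    show "(\<lambda>i. av (c' (Suc i)) * Q ^ Suc i) \<longlonglongrightarrow> 0"
      using LIMSEQ_Suc[OF decay_imp_small[OF decay, unfolded small_def]] .
  qed
  then have "\<exists>a. (\<lambda>i. (- 1) ^ (Suc i + 1) * h i / L_seq \<iota> (Suc i)) sums a"
    by (intro ultrametric_summable) (simp only: tendsto_0_av_iff)
  then have "c0_relation \<iota> c'"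
    unfolding c0_relation_def c'_Suc
    by (simp only: c'_def nat.case) (intro summable_sums, simp add: summable_def)
  moreover have "c' (Suc i) + br i * c' i = c i" for i
  proof (cases i)
    \<comment> \<open>As [0] = 0, the equation at index 0 leaves c'_0 free and reads c'_1 =
      c_0.\<close>
    case 0
    then show ?thesis by (simp add: c'_Suc h_def)
  next
    case (Suc m)
    let ?s = "sum ?g {..<Suc m}"
    have "c' (Suc i) + br i * c' i = (- 1) ^ Suc m * L_seq \<iota> (Suc m) * (?s + ?g (Suc m)) + (- 1) ^ m * L_seq \<iota> (Suc m) * ?s"
      by (simp only: Suc c'_Suc h_def sum.lessThan_Suc[of _ "Suc m"] L_seq_Suc mult.assoc mult.left_commute[of "br (Suc m)"])
    also have "\<dots> = (- 1) ^ Suc m * L_seq \<iota> (Suc m) * ?g (Suc m)"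
      by (simp add: algebra_simps del: sum.lessThan_Suc)
    also have "\<dots> = c i * ((- 1) ^ Suc m * (- 1) ^ Suc m)"
      using L_seq_nonzero[of "Suc m"] by (simp add: Suc del: power_Suc)
    finally show ?thesis by (simp flip: power_mult_distrib)
  qed
  ultimately show ?thesis using decay by blast
qed

text \<open>The invariant of the construction: decay and \<open>c0_relation\<close> produce the next
  coefficients, the expansion identifies \<Delta> of the next function, and the series near 0 gives
  the next series.\<close>

definition good :: "nat \<Rightarrow> ('c \<Rightarrow> 'c) \<Rightarrow> (nat \<Rightarrow> 'c) \<Rightarrow> bool" where
  "good n u c \<longleftrightarrow> cont_linear \<iota> u \<and> coincides_with_polylog_series \<pi> \<iota> n u \<and>
     carlitz_expansion \<iota> c u \<and> decay c \<and> c0_relation \<iota> c"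

text \<open>By the recursion for the coefficients, \<Delta> of the new expansion and v are sums of
  the same series.\<close>

lemma good_step:
  assumes "good n v c"
  shows "\<exists>u c'. good (Suc n) u c' \<and> polylog_solution \<pi> \<iota> (Suc n) v u"
proof -
  from assms have c: "decay c" "c0_relation \<iota> c" "carlitz_expansion \<iota> c v"
    and v: "coincides_with_polylog_series \<pi> \<iota> n v"
    by (auto simp: good_def)
  obtain c' where c': "decay c'" "c0_relation \<iota> c'" "\<And>i. c' (Suc i) + br i * c' i = c i"
    using exists_next_coefficients[OF c(1,2)] by blast
  note small = decay_imp_small[OF c'(1)]
  have Delta: "Delta_op \<iota> (expansion c') t = v t" if "t \<in> O\<^sub>\<pi>" for t
    using Delta_expansion_sums[OF small that] carlitz_expansion_sums[OF c(3) that] sums_unique2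
    unfolding c'(3) by blast
  have "coincides_with_polylog_series \<pi> \<iota> (Suc n) (expansion c')"
    by (rule expansion_coincides[OF small c'(2) v Delta])
  then show ?thesis
    using c' Delta expansion_cont_linear[OF small] carlitz_expansion_expansion[OF small]
    unfolding good_def polylog_solution_def by blast
qed

subsection \<open>Uniqueness\<close>

lemma cont_linear_at_0:
  assumes "cont_linear \<iota> u" "e > 0"
  shows "\<exists>d>0. \<forall>t\<in>O\<^sub>\<pi>. av t < d \<longrightarrow> av (u t) < e"
proof -
  have 0: "0 \<in> O\<^sub>\<pi>" using emb_in_O_set[of 0] by simp
  have "u 0 = 0"
    using Fq_linear_on_diff[of u 0 0] assms(1) 0 by (simp add: cont_linear_def)
  then show ?thesis
    using assms 0 unfolding cont_linear_def continuous_on_iff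
    by (auto simp: dist_av)
qed

text \<open>The difference of two solutions is a multiple of t by \<open>Delta_kernel\<close>, and
  it vanishes at \<open>P\<close>, where both solutions agree with the series.\<close>

lemma polylog_solution_unique:
  assumes "polylog_solution \<pi> \<iota> n v u" "polylog_solution \<pi> \<iota> n v u'"
  shows "u = u'"
proof -
  define w where "w t = u t - u' t" for t
  have cl: "cont_linear \<iota> u" "cont_linear \<iota> u'"
    and D: "\<And>t. t \<in> O\<^sub>\<pi> \<Longrightarrow> Delta_op \<iota> u t = Delta_op \<iota> u' t"
    and co: "coincides_with_polylog_series \<pi> \<iota> n u" "coincides_with_polylog_series \<pi> \<iota> n u'"
    using assms by (auto simp: polylog_solution_def)
  have "Fq_linear_on \<iota> O\<^sub>\<pi> w"
    using cl unfolding cont_linear_def Fq_linear_on_def w_def by (simp add: algebra_simps)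
  moreover have "Delta_op \<iota> w t = 0" if "t \<in> O\<^sub>\<pi>" for t
    using D[OF that] by (simp add: Delta_op_def w_def algebra_simps)
  moreover have "\<exists>d>0. \<forall>t\<in>O\<^sub>\<pi>. av t < d \<longrightarrow> av (w t) < e" if e: "e > 0" for e
  proof -
    obtain d d' where "d > 0" "\<And>t. t \<in> O\<^sub>\<pi> \<Longrightarrow> av t < d \<Longrightarrow> av (u t) < e"
      "d' > 0" "\<And>t. t \<in> O\<^sub>\<pi> \<Longrightarrow> av t < d' \<Longrightarrow> av (u' t) < e"
      using cont_linear_at_0[OF cl(1) e] cont_linear_at_0[OF cl(2) e] by metis
    then show ?thesis
      using av_diff unfolding w_def
      by (intro exI[of _ "min d d'"]) (metis le_less_trans max_less_iff_conj min_less_iff_conj)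
  qed
  ultimately have w: "w t = t * w 1" if "t \<in> O\<^sub>\<pi>" for t
    using Delta_kernel that by blast
  have "w P = 0"
    using coincides_polylog[OF co(1), of P] coincides_polylog[OF co(2), of P] P_mult[OF one_in_O_set]
    by (simp add: w_def)
  then have "w 1 = 0" using w[of P] P_nonzero by simp
  then have "u t = u' t" if "t \<in> O\<^sub>\<pi>" for t using w[OF that] by (simp add: w_def)
  \<comment> \<open>Both functions are extensional, so agreement on \<open>O\<^sub>\<pi>\<close> is
    equality.\<close>
  then show ?thesis
    using cl unfolding cont_linear_def PiE_def by (intro extensionalityI[of u "O\<^sub>\<pi>" u']) auto
qed

subsection \<open>The coefficients of the logarithm\<close>

text \<open>If y had absolute value above 1, then y^q would dominate the other terms.\<close>

lemma artin_schreier_bound: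
  assumes "y ^ CARD('f) - y + a = (0 :: 'c)" "av a \<le> 1"
  shows "av y \<le> 1"
proof (rule ccontr)
  assume y: "\<not> av y \<le> 1"
  have "y ^ CARD('f) = y - a" using assms(1) by (simp add: algebra_simps eq_neg_iff_add_eq_0)
  then have "av y ^ CARD('f) = av (y - a)" by (metis av_power)
  also have "\<dots> \<le> av y" using y assms(2) by (intro av_diff_le) auto
  finally have "av y ^ CARD('f) \<le> av y ^ 1" by simp
  moreover have "av y ^ 1 < av y ^ CARD('f)" using y q_ge_2 by (intro power_strict_increasing) auto
  ultimately show False by linarith
qed

text \<open>Up to index \<delta> the Artin-Schreier equations give integrality. The first gain is
  the factor [\<delta>], of size at most 1 / Q; from there on each series raises the bound to the
  q-th power.\<close>

lemma l1_coefficients_decay: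
  assumes "l1_coefficients \<pi> \<iota> c"
  shows "decay c"
proof -
  have c1: "c 1 ^ CARD('f) - c 1 + 1 = 0"
    and c2: "\<And>i. 1 \<le> i \<Longrightarrow> i < \<delta> \<Longrightarrow> c (i + 1) ^ CARD('f) - c (i + 1) + br i ^ CARD('f) * c i ^ CARD('f) = 0"
    and c3: "\<And>n. n \<ge> \<delta> + 1 \<Longrightarrow> (\<lambda>j. (c (n - 1) * br (n - 1)) ^ (CARD('f) ^ (j + 1))) sums c n"
    using assms by (auto simp: l1_coefficients_def)
  have low: "Suc i \<le> \<delta> \<Longrightarrow> av (c (Suc i)) \<le> 1" for i
  proof (induction i)
    case 0
    then show ?case using artin_schreier_bound[OF c1] by simp
  next
    case (Suc i)
    then have "av (c (Suc i)) \<le> 1" "Suc i < \<delta>" by auto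
    then show ?case
      using artin_schreier_bound[OF c2[of "Suc i"]] by (simp add: av_mult av_power mult_le_one power_le_one)
  qed
  then have low: "av (c \<delta>) \<le> 1"
    using degree_pi_pos low[of "\<delta> - 1"] by simp
  have high: "av (c (\<delta> + d) * br (\<delta> + d)) \<le> 1 / Q ^ (CARD('f) ^ d) \<Longrightarrow> av (c (\<delta> + Suc d)) \<le> 1 / Q ^ (CARD('f) ^ Suc d)" for d
  proof -
    let ?a = "c (\<delta> + d) * br (\<delta> + d)"
    assume a: "av ?a \<le> 1 / Q ^ (CARD('f) ^ d)"
    also have "\<dots> \<le> 1" using Q_gt_1 by (simp add: one_le_power)
    finally have a1: "av ?a \<le> 1" .
    have "(\<lambda>j. ?a ^ (CARD('f) ^ (j + 1))) sums c (\<delta> + Suc d)"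
      using c3[of "\<delta> + Suc d"] by simp
    \<comment> \<open>For a base of size at most 1 the term j = 0, with the smallest exponent q,
      dominates the series.\<close>
    moreover have "av (?a ^ (CARD('f) ^ (j + 1))) \<le> 1 / Q ^ (CARD('f) ^ Suc d)" for j
    proof -
      have "CARD('f) ^ 1 \<le> CARD('f) ^ (j + 1)" using q_ge_2 by (intro power_increasing) auto
      then have "av ?a ^ (CARD('f) ^ (j + 1)) \<le> av ?a ^ CARD('f)"
        using a1 by (intro power_decreasing) auto
      also have "\<dots> \<le> (1 / Q ^ (CARD('f) ^ d)) ^ CARD('f)" using a by (intro power_mono) auto
      also have "\<dots> = 1 / Q ^ (CARD('f) ^ Suc d)" by (simp only: power_one_over power_mult power_Suc2)
      finally show ?thesis by (simp only: av_power)
    qed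
    ultimately show ?thesis by (rule av_sums_le)
  qed
  have "av (c (\<delta> + Suc d)) \<le> 1 / Q ^ (CARD('f) ^ Suc d)" for d
  proof (induction d)
    case 0
    have "av (c \<delta> * br \<delta>) \<le> 1 / Q" using low av_bracket_degree by (rule av_mult_le)
    then show ?case using high[of 0] by simp
  next
    case (Suc d)
    have "av (br (\<delta> + Suc d) * c (\<delta> + Suc d)) \<le> 1 / Q ^ (CARD('f) ^ Suc d)"
      by (rule av_mult_le[OF av_bracket_le_1 Suc])
    then show ?case by (intro high) (simp only: mult.commute)
  qed
  then have "av (c i) \<le> 1 / Q ^ (CARD('f) ^ (i - \<delta>))" if "i > \<delta>" for i
    using that by (metis Suc_diff_Suc add_diff_inverse_nat less_imp_le not_less)
  then show ?thesis unfolding decay_def by (intro exI[of _ 1]) simp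
qed

lemma good_l1: "is_l1 \<pi> \<iota> l1 \<Longrightarrow> \<exists>c. good 1 l1 c"
  unfolding is_l1_def good_def using l1_coefficients_decay by (auto simp: l1_coefficients_def)

text \<open>Each function is chosen after its predecessor, hence dependent choice. The chosen
  sequence is indexed so that \<open>f n\<close> stands for l_(n+1), and the clause for n = 0 in
  \<open>?P\<close> pins its start to \<open>l1\<close>.\<close>

lemma exists_polylogs:
  assumes "is_l1 \<pi> \<iota> l1"
  shows "\<exists>l. l 1 = l1 \<and> (\<forall>n\<ge>2. polylog_solution \<pi> \<iota> n (l (n - 1)) (l n) \<and> (\<exists>c. good n (l n) c))"
proof -
  let ?P = "\<lambda>n u. (\<exists>c. good (Suc n) u c) \<and> (n = 0 \<longrightarrow> u = l1)"
  have "\<exists>f. \<forall>n. ?P n (f n) \<and> polylog_solution \<pi> \<iota> (Suc (Suc n)) (f n) (f (Suc n))"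
  proof (rule dependent_nat_choice)
    show "\<exists>u. ?P 0 u" using good_l1[OF assms] by auto
    show "\<exists>u. ?P (Suc n) u \<and> polylog_solution \<pi> \<iota> (Suc (Suc n)) v u" if "?P n v" for v n
      using that good_step by blast
  qed
  then obtain f where f: "\<And>n. ?P n (f n)" "\<And>n. polylog_solution \<pi> \<iota> (Suc (Suc n)) (f n) (f (Suc n))"
    by blast
  show ?thesis
  \<comment> \<open>Truncated subtraction gives index 0 the value \<open>l1\<close> too, a default
    outside the claim.\<close>
  proof (intro exI[of _ "\<lambda>n. f (n - 1)"] conjI allI impI)
    show "f (1 - 1) = l1" using f(1)[of 0] by simp
    fix n :: nat assume "n \<ge> 2"
    then obtain m where "n = Suc (Suc m)" using less_eqE[of 2 n] by auto
    then show "polylog_solution \<pi> \<iota> n (f (n - 1 - 1)) (f (n - 1))" "\<exists>c. good n (f (n - 1)) c"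
      using f(1)[of "Suc m"] f(2)[of m] by simp_all
  qed
qed

end

theorem theorem2:
  fixes \<pi> :: "'f::{field,finite} poly"
    and \<iota> :: "'f poly fract \<Rightarrow> 'c::{field,complete_space}"
    and l1 :: "'c \<Rightarrow> 'c"
  assumes "Factorial_Ring.irreducible \<pi>" and "Polynomial.lead_coeff \<pi> = 1"
    and "is_Omega \<pi> \<iota>"
    and "is_l1 \<pi> \<iota> l1"
  shows "\<exists>l :: nat \<Rightarrow> 'c \<Rightarrow> 'c. l 1 = l1 \<and>
    (\<forall>n\<ge>2.
       polylog_solution \<pi> \<iota> n (l (n - 1)) (l n) \<and>
       (\<forall>u. polylog_solution \<pi> \<iota> n (l (n - 1)) u \<longrightarrow> u = l n) \<and>
       (\<exists>c :: nat \<Rightarrow> 'c.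
          carlitz_expansion \<iota> c (l n) \<and>
          (\<exists>C>0. \<forall>i>Polynomial.degree \<pi>.
             av (c i) \<le> C * real CARD('f) powr
               (- real (Polynomial.degree \<pi> * CARD('f) ^ (i - Polynomial.degree \<pi>)))) \<and>
          c0_relation \<iota> c))"
proof -
  interpret carlitz \<pi> \<iota>
    by standard (fact assms)+
  obtain l where l: "l 1 = l1"
    "\<And>n. n \<ge> 2 \<Longrightarrow> polylog_solution \<pi> \<iota> n (l (n - 1)) (l n)"
    "\<And>n. n \<ge> 2 \<Longrightarrow> \<exists>c. good n (l n) c"
    using exists_polylogs[OF assms(4)] by blast
  show ?thesis
  proof (intro exI[of _ l] conjI allI impI)
    show "l 1 = l1" by (fact l(1))
    fix n :: nat assume n: "n \<ge> 2"
    show "polylog_solution \<pi> \<iota> n (l (n - 1)) (l n)" by (rule l(2)[OF n])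
    then show "u = l n" if "polylog_solution \<pi> \<iota> n (l (n - 1)) u" for u
      using polylog_solution_unique that by blast
    show "\<exists>c. carlitz_expansion \<iota> c (l n) \<and>
        (\<exists>C>0. \<forall>i>\<delta>. av (c i) \<le> C * real CARD('f) powr (- real (\<delta> * CARD('f) ^ (i - \<delta>)))) \<and>
        c0_relation \<iota> c"
      using l(3)[OF n] unfolding good_def decay_iff by blast
  qed
qed

end
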